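(* Let Assumptions 1-4 of the context hold and let the agents execute the asynchronous primal-dual algorithm described in the context. Then there exist constants $K_1,K_2>0$ such that, for all $t$ (and for every primal agent $i$ and every time $k$ at which $\mu(t)$ is onboard the primal agents), $$\|x^i(k;t)-\hat{x}_\delta\|_2\le K_1q_p^{\mathrm{ops}(k,t)}+K_2\|\mu(t)-\hat{\mu}_\delta\|_2,$$ where $q_p=1-\gamma\beta$.
   Context: Data: $h:\mathbb{R}^n\to\mathbb{R}$, $g:\mathbb{R}^n\to\mathbb{R}^m$, $X\subset\mathbb{R}^n$, $\delta>0$, $\beta>0$. Regularized Lagrangian: $L_\delta(x,\mu)=h(x)+\mu^Tg(x)-\frac{\delta}{2}\|\mu\|^2$ (Euclidean norm), Hessian $H(x,\mu)=\nabla_x^2L_\delta(x,\mu)$. $(\hat{x}_\delta,\hat{\mu}_\delta)=\arg\min_{x\in X}\arg\max_{\mu\in\mathbb{R}^m_+}L_\delta(x,\mu)$ is its saddle point. Assumption 1: $h$ is twice continuously differentiable and convex. Assumption 2: there is $\bar{x}\in X$ with $g(\bar{x})<0$ componentwise (a Slater point), and each $g_j$ is twice continuously differentiable and convex. Assumption 3: $X$ is non-empty, compact and convex, and $X=X_1\times\cdots\times X_n$ with scalar blocks $X_i\subset\mathbb{R}$. Assumption 4 ($\beta$-diagonal dominance): $|H_{ii}(x,\mu)|-\beta\ge\sum_{j\ne i}|H_{ij}(x,\mu)|$ for all $i\in\{1,\dots,n\}$, for all $x\in X$, $\mu\in\mathbb{R}^m_+$. With $h^*:=\min_{x\in X}h(x)$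 and $B:=\frac{h(\bar{x})-h^*}{\min_{1\le j\le m}-g_j(\bar{x})}$, set $M:=\{\mu\in\mathbb{R}^m_+:\|\mu\|_1\le B\}$ and $M_c:=\{\nu\in\mathbb{R}_+:\nu\le B\}$. The primal step-size $\gamma>0$ satisfies $\gamma<1/\big(\max_i\max_{x\in X}\max_{\mu\in M}\sum_{j=1}^n|H_{ij}(x,\mu)|\big)$; $\rho>0$ is the dual step-size. $\Pi_S$ is Euclidean projection onto $S$, and $\|\cdot\|_2$ is the Euclidean norm (over all components of the vector). Algorithm. Primal agents $i\in[N_p]=\{1,\dots,n\}$ (agent $i$ alone updates the scalar $x_i$); dual agents $c\in[N_d]=\{1,\dots,m\}$ (agent $c$ alone updates the scalar $\mu_c$). Agent $a$'s local copies of the full primal and dual vectors are $x^a,\mu^a$. The primal agents share the time counter $k$; dual agent $c$ has iteration count $t_c$; $t=(t_1,\dots,t_m)$; $\mu(t)$ is the dual vector with entries $\mu^c_c(t_c)$. $x^i(k;t)\in\mathbb{R}^n$ is primal agent $i$'s vector at time $k$ with $\mu(t)$ onboard. Agent $j$ is an essential neighbor of $i$ ($j\in\mathcal{N}_i$, $j\neq i$) if $\nabla_{x_j}L_\delta$ depends on $x_i$. All agents are initialized with $x(0)\in X$, $\mu(0)\in M$, $k=0$, $t=0$. Messages are sent at arbitrary times and received without delay. Repeat: (1) at arbitrary times, primal agents send their current own entries to essential neighbors; (2) when dual agent $c$ sends an update it is received simultaneously by all primal agents together with $t_c$; they update $t$ and set $\mu^i_c(t)=\mu^c_c(t_c)$,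 so all primal agents always agree on $\mu(t)$; primal messages computed with outdated dual values are disregarded; (3) with $K^i\subset\mathbb{N}$ the set of times agent $i$ computes, $x^i_i(k+1;t)=\Pi_{X_i}[x^i_i(k;t)-\gamma\nabla_{x_i}L_\delta(x^i(k;t),\mu(t))]$ if $k\in K^i$ and $x^i_i(k+1;t)=x^i_i(k;t)$ otherwise; for $j\in\mathcal{N}_i$, $x^i_j(k+1;t)=x^j_j(\tau^i_j(k+1);t)$ if $i$ receives $j$'s state at time $k+1$ (where $\tau^i_j(k+1)$ is the time $j$ computed the value sent), else $x^i_j(k+1;t)=x^i_j(k;t)$; (4) at arbitrary times primal agent $i$ sends $x^i_i$ to dual agent $c$; then $k:=k+1$; (5) if dual agent $c$ receives an update from primal agent $i$ computed with dual iterate $t$, it sets $x^c_i(t_c)$ to the (most recent) value of $x^i_i$ received prior to its update $t_c+1$, and otherwise $x^c_i(t_c)=x^c_i(t_c-1)$; (6) once dual agent $c$ has received an update from every primal agent for the latest dual iteration $t$, it sets $\mu^c_c(t_c+1)=\Pi_{M_c}\big[\mu^c_c(t_c)+\rho\frac{\partial L_\delta}{\partial\mu_c}(x^c(t_c),\mu^c(t_c))\big]$, i.e. with derivative $g_c(x^c(t_c))-\delta\mu^c_c(t_c)$; (7) if it updated in (6), dual agent $c$ sends $\mu^c_c(t_c+1)$ to all primal agents and sets $t_c:=t_c+1$. Operation count: $\mathrm{ops}(k,t)=0$ when $\mu(t)$ comes onboard the primal agents. Each time all primal agents have (since the previous increment) computed an update using $\mu(t)$, sent it, and had it received by all other primal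 agents that need it, $\mathrm{ops}(\cdot,t)$ increases by $1$. When a new dual value arrives (iteration vector $t'$), a new count starts with $\mathrm{ops}(\cdot,t')=0$.
   Formalization: In x^i(k;t), an entry j≠i with j not an essential neighbor of i is read from its owner, agent j, not from agent i's copy: that copy is never updated, so the literal bound fails (e.g. h=½‖x−(1,1)‖², g=−1, X=[0,2]², x(0)=0). *)

theory Defs
  imports "HOL-Analysis.Analysis"
begin

definition grad :: "(real^'n \<Rightarrow> real) \<Rightarrow> real^'n \<Rightarrow> real^'n" where
  "grad f x = (\<chi> i. frechet_derivative f (at x) (axis i 1))"

definition hessian :: "(real^'n \<Rightarrow> real) \<Rightarrow> real^'n \<Rightarrow> real^'n^'n" where
  "hessian f x = jacobian (grad f) (at x)"

definition twice_cont_diff :: "(real^'n \<Rightarrow> real) \<Rightarrow> bool" where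
  "twice_cont_diff f \<longleftrightarrow>
     (\<forall>x. f differentiable (at x)) \<and>
     (\<forall>x. grad f differentiable (at x)) \<and>
     continuous_on UNIV (hessian f)"

definition nonneg_orthant :: "(real^'m) set" where
  "nonneg_orthant = {\<mu>. \<forall>c. 0 \<le> \<mu> $ c}"

definition lagrangian ::
  "(real^'n \<Rightarrow> real) \<Rightarrow> (real^'n \<Rightarrow> real^'m) \<Rightarrow> real \<Rightarrow> real^'n \<Rightarrow> real^'m \<Rightarrow> real" where
  "lagrangian h g \<delta> x \<mu> = h x + \<mu> \<bullet> g x - \<delta> / 2 * (norm \<mu>)\<^sup>2"

definition lagrangian_grad ::
  "(real^'n \<Rightarrow> real) \<Rightarrow> (real^'n \<Rightarrow> real^'m) \<Rightarrow> real \<Rightarrow> real^'n \<Rightarrow> real^'m \<Rightarrow> real^'n" where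
  "lagrangian_grad h g \<delta> x \<mu> = grad (\<lambda>y. lagrangian h g \<delta> y \<mu>) x"

definition lagrangian_hessian ::
  "(real^'n \<Rightarrow> real) \<Rightarrow> (real^'n \<Rightarrow> real^'m) \<Rightarrow> real \<Rightarrow> real^'n \<Rightarrow> real^'m \<Rightarrow> real^'n^'n" where
  "lagrangian_hessian h g \<delta> x \<mu> = hessian (\<lambda>y. lagrangian h g \<delta> y \<mu>) x"

definition is_saddle_point ::
  "(real^'n \<Rightarrow> real^'m \<Rightarrow> real) \<Rightarrow> (real^'n) set \<Rightarrow> (real^'m) set \<Rightarrow> real^'n \<Rightarrow> real^'m \<Rightarrow> bool"
where
  "is_saddle_point L X Y xh \<mu>h \<longleftrightarrow>
     xh \<in> X \<and> \<mu>h \<in> Y \<and>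
     (\<forall>\<mu>\<in>Y. L xh \<mu> \<le> L xh \<mu>h) \<and> (\<forall>x\<in>X. L xh \<mu>h \<le> L x \<mu>h)"

definition slater_point :: "(real^'n \<Rightarrow> real^'m) \<Rightarrow> (real^'n) set \<Rightarrow> real^'n \<Rightarrow> bool" where
  "slater_point g X xbar \<longleftrightarrow> xbar \<in> X \<and> (\<forall>j. g xbar $ j < 0)"

definition diag_dominant ::
  "(real^'n \<Rightarrow> real) \<Rightarrow> (real^'n \<Rightarrow> real^'m) \<Rightarrow> real \<Rightarrow> (real^'n) set \<Rightarrow> real \<Rightarrow> bool" where
  "diag_dominant h g \<delta> X \<beta> \<longleftrightarrow>
     (\<forall>i. \<forall>x\<in>X. \<forall>\<mu>\<in>nonneg_orthant.
        \<bar>lagrangian_hessian h g \<delta> x \<mu> $ i $ i\<bar> - \<beta>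
          \<ge> (\<Sum>j\<in>UNIV - {i}. \<bar>lagrangian_hessian h g \<delta> x \<mu> $ i $ j\<bar>))"

definition dual_bound ::
  "(real^'n \<Rightarrow> real) \<Rightarrow> (real^'n \<Rightarrow> real^'m) \<Rightarrow> (real^'n) set \<Rightarrow> real^'n \<Rightarrow> real" where
  "dual_bound h g X xbar =
     (h xbar - (INF x\<in>X. h x)) / Min (range (\<lambda>j. - (g xbar $ j)))"

definition dual_set :: "real \<Rightarrow> (real^'m) set" where
  "dual_set B = {\<mu>\<in>nonneg_orthant. (\<Sum>c\<in>UNIV. \<bar>\<mu> $ c\<bar>) \<le> B}"

text \<open>
  Only meaningful for \<open>C\<^sup>2\<close> data and compact \<open>X\<close>, where the supremum is a maximum.
\<close>
definition max_row_sum ::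
  "(real^'n \<Rightarrow> real) \<Rightarrow> (real^'n \<Rightarrow> real^'m) \<Rightarrow> real \<Rightarrow> (real^'n) set \<Rightarrow> (real^'m) set \<Rightarrow> real"
where
  "max_row_sum h g \<delta> X M =
     (SUP (i, x, \<mu>) \<in> UNIV \<times> X \<times> M. \<Sum>j\<in>UNIV. \<bar>lagrangian_hessian h g \<delta> x \<mu> $ i $ j\<bar>)"

definition essential_neighbors ::
  "(real^'n \<Rightarrow> real) \<Rightarrow> (real^'n \<Rightarrow> real^'m) \<Rightarrow> real \<Rightarrow> 'n \<Rightarrow> 'n set" where
  "essential_neighbors h g \<delta> i =
     {j. j \<noteq> i \<and>
         (\<exists>\<mu>\<in>nonneg_orthant. \<exists>x y. (\<forall>l. l \<noteq> i \<longrightarrow> x $ l = y $ l) \<and>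
            lagrangian_grad h g \<delta> x \<mu> $ j \<noteq> lagrangian_grad h g \<delta> y \<mu> $ j)}"

text \<open>
  The primal clock \<open>k\<close> is never reset, so one sequence \<open>x i k\<close> carries all the vectors
  \<open>x\<^sup>i(k;t)\<close>. Iteration \<open>k\<close> is one pass of the loop, leading from time \<open>k\<close> to time
  \<open>Suc k\<close>. The schedule is arbitrary:
  \<^item> \<open>K i\<close>: the iterations in which primal agent \<open>i\<close> computes;
  \<^item> \<open>S j i\<close>: the iterations at whose start primal agent \<open>j\<close> sends its entry to primal
    agent \<open>i\<close>;
  \<^item> \<open>D i c\<close>: the iterations in which primal agent \<open>i\<close> sends its entry to dual agent \<open>c\<close>
    (after having computed, if it does).

  The rest is determined by it:
  \<^item> \<open>t k\<close>: the dual iteration vector the primal agents have onboard in iteration \<open>k\<close>, after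
    the arrival of the dual updates made in iteration \<open>k - 1\<close>;
  \<^item> \<open>\<mu> c s\<close>: the entry of dual agent \<open>c\<close> after \<open>s\<close> updates;
  \<^item> \<open>z c k\<close>: the copy of the primal vector held by dual agent \<open>c\<close> at time \<open>k\<close>.
\<close>

definition dual_vector :: "('m \<Rightarrow> nat \<Rightarrow> real) \<Rightarrow> ('m \<Rightarrow> nat) \<Rightarrow> real^'m" where
  "dual_vector \<mu> T = (\<chi> c. \<mu> c (T c))"

text \<open>
  The own entry of agent \<open>j\<close> at time \<open>k\<close> is an update, and it was computed in iteration
  \<open>\<kappa>\<close>. The entry is then \<open>x j (Suc \<kappa>) $ j\<close>.
\<close>
definition computed_in :: "('n \<Rightarrow> nat set) \<Rightarrow> 'n \<Rightarrow> nat \<Rightarrow> nat \<Rightarrow> bool" where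
  "computed_in K j k \<kappa> \<longleftrightarrow> \<kappa> \<in> K j \<and> \<kappa> < k \<and> (\<forall>s\<in>K j. s < k \<longrightarrow> s \<le> \<kappa>)"

text \<open>
  Agent \<open>i\<close> accepts a message sent by \<open>j\<close> in iteration \<open>k\<close> and containing the update which
  \<open>j\<close> computed in iteration \<open>\<kappa>\<close>; the last conjunct discards updates that were computed with
  an outdated dual vector.
\<close>
definition receives ::
  "('n \<Rightarrow> nat set) \<Rightarrow> ('n \<Rightarrow> 'n \<Rightarrow> nat set) \<Rightarrow> (nat \<Rightarrow> 'm \<Rightarrow> nat)
     \<Rightarrow> 'n \<Rightarrow> 'n \<Rightarrow> nat \<Rightarrow> nat \<Rightarrow> bool" where
  "receives K S t i j k \<kappa> \<longleftrightarrow> k \<in> S j i \<and> computed_in K j k \<kappa> \<and> t \<kappa> = t k"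

definition dual_receives ::
  "('n \<Rightarrow> nat set) \<Rightarrow> ('n \<Rightarrow> 'm \<Rightarrow> nat set) \<Rightarrow> (nat \<Rightarrow> 'm \<Rightarrow> nat)
     \<Rightarrow> 'm \<Rightarrow> 'n \<Rightarrow> nat \<Rightarrow> bool" where
  "dual_receives K D t c i k \<longleftrightarrow>
     k \<in> D i c \<and> (\<exists>\<kappa>. computed_in K i (Suc k) \<kappa> \<and> t \<kappa> = t k)"

definition dual_updates ::
  "('n \<Rightarrow> nat set) \<Rightarrow> ('n \<Rightarrow> 'm \<Rightarrow> nat set) \<Rightarrow> (nat \<Rightarrow> 'm \<Rightarrow> nat) \<Rightarrow> 'm \<Rightarrow> nat \<Rightarrow> bool"
where
  "dual_updates K D t c k \<longleftrightarrow> (\<forall>i. \<exists>r\<le>k. t r = t k \<and> dual_receives K D t c i r)"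

definition async_primal_dual ::
  "(real^'n \<Rightarrow> real) \<Rightarrow> (real^'n \<Rightarrow> real^'m) \<Rightarrow> real \<Rightarrow> ('n \<Rightarrow> real set) \<Rightarrow> real
     \<Rightarrow> real \<Rightarrow> real \<Rightarrow> real^'n \<Rightarrow> real^'m
     \<Rightarrow> ('n \<Rightarrow> nat set) \<Rightarrow> ('n \<Rightarrow> 'n \<Rightarrow> nat set) \<Rightarrow> ('n \<Rightarrow> 'm \<Rightarrow> nat set)
     \<Rightarrow> ('n \<Rightarrow> nat \<Rightarrow> real^'n) \<Rightarrow> (nat \<Rightarrow> 'm \<Rightarrow> nat)
     \<Rightarrow> ('m \<Rightarrow> nat \<Rightarrow> real) \<Rightarrow> ('m \<Rightarrow> nat \<Rightarrow> real^'n) \<Rightarrow> bool" where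
  "async_primal_dual h g \<delta> Xs B \<gamma> \<rho> x0 \<mu>0 K S D x t \<mu> z \<longleftrightarrow>
     (\<forall>i. x i 0 = x0) \<and> (\<forall>c. z c 0 = x0) \<and> (\<forall>c. \<mu> c 0 = \<mu>0 $ c) \<and> (\<forall>c. t 0 c = 0) \<and>
     (\<forall>i k. x i (Suc k) $ i =
        (if k \<in> K i
         then closest_point (Xs i)
                (x i k $ i - \<gamma> * lagrangian_grad h g \<delta> (x i k) (dual_vector \<mu> (t k)) $ i)
         else x i k $ i)) \<and>
     (\<forall>i k. \<forall>j\<in>essential_neighbors h g \<delta> i.
        (\<forall>\<kappa>. receives K S t i j k \<kappa> \<longrightarrow> x i (Suc k) $ j = x j (Suc \<kappa>) $ j) \<and>
        ((\<nexists>\<kappa>. receives K S t i j k \<kappa>) \<longrightarrow> x i (Suc k) $ j = x i k $ j)) \<and>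
     \<comment> \<open>the remaining copies are neither communicated nor used\<close>
     (\<forall>i k j. j \<noteq> i \<and> j \<notin> essential_neighbors h g \<delta> i \<longrightarrow> x i (Suc k) $ j = x i k $ j) \<and>
     (\<forall>c k i. z c (Suc k) $ i =
        (if dual_receives K D t c i k then x i (Suc k) $ i else z c k $ i)) \<and>
     (\<forall>c k. dual_updates K D t c k \<longrightarrow>
        t (Suc k) c = Suc (t k c) \<and>
        \<mu> c (Suc (t k c)) =
          closest_point {0..B} (\<mu> c (t k c) + \<rho> * (g (z c (Suc k)) $ c - \<delta> * \<mu> c (t k c)))) \<and>
     (\<forall>c k. \<not> dual_updates K D t c k \<longrightarrow> t (Suc k) c = t k c)"

text \<open>
  At the time \<open>k\<close> when a new dual vector arrives, both the old one (with which the vectors at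
  time \<open>k\<close> were computed) and the new one count as onboard.
\<close>
definition onboard :: "(nat \<Rightarrow> 'm \<Rightarrow> nat) \<Rightarrow> nat \<Rightarrow> ('m \<Rightarrow> nat) \<Rightarrow> bool" where
  "onboard t k T \<longleftrightarrow> T = t k \<or> (\<exists>l. k = Suc l \<and> T = t l)"

text \<open>
  The vector \<open>x\<^sup>i(k;t)\<close> of agent \<open>i\<close>. Entry \<open>j\<close> is the copy held by agent \<open>i\<close> if \<open>j = i\<close> or
  \<open>j\<close> is an essential neighbor of \<open>i\<close>. Any other entry is never sent to agent \<open>i\<close> and has no
  influence on its computations; the copy thus stays at its initial value for ever, and no
  convergence holds for it. Such an entry is read off from its owner, agent \<open>j\<close>.
\<close>
definition primal_vector ::
  "('n \<Rightarrow> 'n set) \<Rightarrow> ('n \<Rightarrow> nat \<Rightarrow> real^'n) \<Rightarrow> 'n \<Rightarrow> nat \<Rightarrow> real^'n" where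
  "primal_vector N x i k = (\<chi> j. if j = i \<or> j \<in> N i then x i k $ j else x j k $ j)"

text \<open>
  By time \<open>k\<close>, every agent \<open>j\<close> has computed an update with dual vector \<open>T\<close> in an iteration
  \<open>\<kappa> \<ge> l\<close>, and that update has been received by every agent that needs it.
\<close>
definition round_complete ::
  "('n \<Rightarrow> 'n set) \<Rightarrow> ('n \<Rightarrow> nat set) \<Rightarrow> ('n \<Rightarrow> 'n \<Rightarrow> nat set) \<Rightarrow> (nat \<Rightarrow> 'm \<Rightarrow> nat)
     \<Rightarrow> ('m \<Rightarrow> nat) \<Rightarrow> nat \<Rightarrow> nat \<Rightarrow> bool" where
  "round_complete N K S t T l k \<longleftrightarrow>
     (\<forall>j. \<exists>\<kappa>\<in>K j. l \<le> \<kappa> \<and> \<kappa> < k \<and> t \<kappa> = T \<and>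
        (\<forall>i. j \<in> N i \<longrightarrow> (\<exists>r<k. receives K S t i j r \<kappa>)))"

text \<open>The number of increments up to time \<open>k\<close> and the time of the last one.\<close>
primrec ops_state ::
  "('n \<Rightarrow> 'n set) \<Rightarrow> ('n \<Rightarrow> nat set) \<Rightarrow> ('n \<Rightarrow> 'n \<Rightarrow> nat set) \<Rightarrow> (nat \<Rightarrow> 'm \<Rightarrow> nat)
     \<Rightarrow> ('m \<Rightarrow> nat) \<Rightarrow> nat \<Rightarrow> nat \<times> nat" where
  "ops_state N K S t T 0 = (0, 0)"
| "ops_state N K S t T (Suc k) =
     (let (r, l) = ops_state N K S t T k
      in if round_complete N K S t T l (Suc k) then (Suc r, Suc k) else (r, l))"

text \<open>
  Updates computed before \<open>T\<close> comes onboard do not count, so that the count is \<open>0\<close> at that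
  time.
\<close>
definition ops ::
  "('n \<Rightarrow> 'n set) \<Rightarrow> ('n \<Rightarrow> nat set) \<Rightarrow> ('n \<Rightarrow> 'n \<Rightarrow> nat set) \<Rightarrow> (nat \<Rightarrow> 'm \<Rightarrow> nat)
     \<Rightarrow> nat \<Rightarrow> ('m \<Rightarrow> nat) \<Rightarrow> nat" where
  "ops N K S t k T = fst (ops_state N K S t T k)"

end

theory Submission
  imports Defs
begin

text \<open>
  Fix the dual vector \<open>\<mu>\<close> onboard. The saddle point component \<open>xhat\<close> is a fixed point of the
  projected gradient step with multiplier \<open>muhat\<close>. By diagonal dominance the projected gradient
  step is a contraction in the maximum norm with factor \<open>q = 1 - \<gamma> * \<beta>\<close>, so the step with \<open>\<mu>\<close>
  takes an error \<open>e\<close> with respect to \<open>xhat\<close> to at most \<open>q * e + d\<close>, where \<open>d\<close> is proportional to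
  \<open>norm (\<mu> - muhat)\<close>. Each completed round of updates and messages thus takes the error bound
  \<open>R * q ^ r + d / (1 - q)\<close> to the same expression with \<open>Suc r\<close>. The contraction needs \<open>\<mu>\<close> to be
  close to \<open>muhat\<close>, since the step size is only chosen for multipliers in the dual set, which
  contains \<open>muhat\<close> but not all dual iterates; for the other \<open>\<mu>\<close> the term with
  \<open>norm (\<mu> - muhat)\<close> exceeds the diameter of \<open>X\<close> when its coefficient is large enough.
\<close>

section \<open>Gradients, Hessians and restrictions to lines\<close>

lemma grad_eqI:
  fixes f :: "real^'n \<Rightarrow> real"
  assumes "(f has_derivative (\<lambda>v. G \<bullet> v)) (at x)"
  shows "grad f x = G"
proof -
  have "frechet_derivative f (at x) = (\<lambda>v. G \<bullet> v)"
    using frechet_derivative_at[OF assms] by simp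
  then show ?thesis
    by (simp add: grad_def vec_eq_iff inner_axis)
qed

lemma has_derivative_grad:
  fixes f :: "real^'n \<Rightarrow> real"
  assumes "f differentiable (at x)"
  shows "(f has_derivative (\<lambda>v. grad f x \<bullet> v)) (at x)"
proof -
  let ?D = "frechet_derivative f (at x)"
  have D: "(f has_derivative ?D) (at x)"
    using assms by (simp add: frechet_derivative_works)
  then interpret linear ?D
    by (rule has_derivative_linear)
  have "?D v = grad f x \<bullet> v" for v
  proof -
    have "?D v = ?D (\<Sum>i\<in>UNIV. v $ i *\<^sub>R axis i 1)"
      using basis_expansion[of v] by (simp add: scalar_mult_eq_scaleR)
    also have "\<dots> = grad f x \<bullet> v"
      by (simp add: sum scaleR grad_def inner_vec_def mult.commute)
    finally show ?thesis .
  qed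
  then have "?D = (\<lambda>v. grad f x \<bullet> v)" ..
  with D show ?thesis by simp
qed

lemma hessian_eqI:
  fixes f :: "real^'n \<Rightarrow> real"
  assumes "(grad f has_derivative (\<lambda>v. A *v v)) (at x)"
  shows "hessian f x = A"
  using frechet_derivative_at[OF assms] by (simp add: hessian_def jacobian_def)
    (metis matrix_of_matrix_vector_mul)

lemma has_derivative_hessian:
  fixes f :: "real^'n \<Rightarrow> real"
  assumes "grad f differentiable (at x)"
  shows "(grad f has_derivative (\<lambda>v. hessian f x *v v)) (at x)"
  using assms by (simp add: hessian_def jacobian_works)

lemma line_has_real_derivative:
  fixes f :: "real^'n \<Rightarrow> real"
  assumes "(f has_derivative D) (at (y + s *\<^sub>R v))"
  shows "((\<lambda>s. f (y + s *\<^sub>R v)) has_real_derivative D v) (at s)"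
proof -
  have "((\<lambda>s. y + s *\<^sub>R v) has_derivative (\<lambda>s. s *\<^sub>R v)) (at s)"
    by (auto intro!: derivative_eq_intros)
  from diff_chain_at[OF this assms] has_derivative_linear[OF assms]
  show ?thesis
    by (simp add: o_def linear_scale has_field_derivative_def mult_commute_abs)
qed

lemma axis_line_has_real_derivative:
  fixes f :: "real^'n \<Rightarrow> real"
  assumes "f differentiable (at (y + s *\<^sub>R axis i 1))"
  shows "((\<lambda>s. f (y + s *\<^sub>R axis i 1)) has_real_derivative
    grad f (y + s *\<^sub>R axis i 1) $ i) (at s)"
  using line_has_real_derivative[OF has_derivative_grad[OF assms]]
  by (simp add: inner_axis)

text \<open>The restriction of \<open>f\<close> to a line in direction \<open>i\<close> is convex.
  Its tangent inequalities at two points make the derivative nondecreasing, and the derivative of a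
  nondecreasing function is nonnegative.\<close>

lemma convex_hessian_diagonal_nonneg:
  fixes f :: "real^'n \<Rightarrow> real"
  assumes f: "\<And>x. f differentiable (at x)" "\<And>x. grad f differentiable (at x)"
    and "convex_on UNIV f"
  shows "0 \<le> hessian f x $ i $ i"
proof -
  let ?v = "axis i 1 :: real^'n"
  let ?p = "\<lambda>s. f (x + s *\<^sub>R ?v)"
  let ?p' = "\<lambda>s. grad f (x + s *\<^sub>R ?v) $ i"
  have cv: "convex_on UNIV ?p"
  proof (rule convex_onI)
    fix \<tau> a b :: real assume "0 < \<tau>" "\<tau> < 1"
    then have "f ((1 - \<tau>) *\<^sub>R (x + a *\<^sub>R ?v) + \<tau> *\<^sub>R (x + b *\<^sub>R ?v))
        \<le> (1 - \<tau>) * ?p a + \<tau> * ?p b"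
      using assms(3) by (intro convex_onD) auto
    moreover have "(1 - \<tau>) *\<^sub>R (x + a *\<^sub>R ?v) + \<tau> *\<^sub>R (x + b *\<^sub>R ?v)
        = x + ((1 - \<tau>) *\<^sub>R a + \<tau> *\<^sub>R b) *\<^sub>R ?v"
      by (simp add: algebra_simps)
    ultimately show "?p ((1 - \<tau>) *\<^sub>R a + \<tau> *\<^sub>R b) \<le> (1 - \<tau>) * ?p a + \<tau> * ?p b"
      by simp
  qed simp
  have d: "(?p has_real_derivative ?p' s) (at s)" for s
    using f(1) by (rule axis_line_has_real_derivative)
  have tangent: "?p b - ?p a \<ge> ?p' a * (b - a)" for a b
    using convex_on_imp_above_tangent[OF cv _ _ _ d[of a]] by auto
  have "?p' a \<le> ?p' b" if "a \<le> b" for a b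
  proof (cases "a = b")
    case False
    have "?p' a * (b - a) \<le> ?p' b * (b - a)"
      using tangent[of a b] tangent[of b a] by (simp add: algebra_simps)
    with False that show ?thesis by simp
  qed simp
  then have "mono_on UNIV ?p'"
    by (simp add: mono_on_def)
  moreover have "(?p' has_real_derivative hessian f x $ i $ i) (at 0)"
  proof -
    have "(grad f has_derivative (\<lambda>v. hessian f x *v v)) (at (x + 0 *\<^sub>R ?v))"
      using has_derivative_hessian[OF f(2)] by simp
    then have "((\<lambda>y. grad f y $ i) has_derivative (\<lambda>v. (hessian f x *v v) $ i))
        (at (x + 0 *\<^sub>R ?v))"
      by (rule bounded_linear.has_derivative[OF bounded_linear_vec_nth])
    from line_has_real_derivative[OF this] show ?thesis
      by (simp add: matrix_vector_mul_component inner_axis)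
  qed
  ultimately show ?thesis
    using mono_on_imp_deriv_nonneg[of UNIV ?p' _ 0] by auto
qed

section \<open>First and second derivatives of the Lagrangian\<close>

text \<open>The quadratic term in \<open>\<mu>\<close> is constant in the primal variable and
  disappears. What remains is affine in \<open>\<mu>\<close>, which is the source of the later
  Lipschitz bounds in the multiplier.\<close>

lemma lagrangian_grad_eq:
  fixes h :: "real^'n \<Rightarrow> real" and g :: "real^'n \<Rightarrow> real^'m"
  assumes "h differentiable (at x)" "\<And>c. (\<lambda>y. g y $ c) differentiable (at x)"
  shows "((\<lambda>y. lagrangian h g \<delta> y \<mu>) has_derivative (\<lambda>v. lagrangian_grad h g \<delta> x \<mu> \<bullet> v)) (at x)"
    and "lagrangian_grad h g \<delta> x \<mu> = grad h x + (\<Sum>c\<in>UNIV. \<mu> $ c *\<^sub>R grad (\<lambda>y. g y $ c) x)"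
proof -
  let ?G = "grad h x + (\<Sum>c\<in>UNIV. \<mu> $ c *\<^sub>R grad (\<lambda>y. g y $ c) x)"
  have "((\<lambda>y. h y + (\<Sum>c\<in>UNIV. \<mu> $ c * g y $ c) - \<delta> / 2 * (norm \<mu>)\<^sup>2) has_derivative
      (\<lambda>v. grad h x \<bullet> v + (\<Sum>c\<in>UNIV. \<mu> $ c * (grad (\<lambda>y. g y $ c) x \<bullet> v)) - 0)) (at x)"
    by (intro has_derivative_diff has_derivative_add has_derivative_sum has_derivative_mult_right
        has_derivative_grad has_derivative_const assms)
  then have *: "((\<lambda>y. lagrangian h g \<delta> y \<mu>) has_derivative (\<lambda>v. ?G \<bullet> v)) (at x)"
    by (simp add: lagrangian_def inner_vec_def[of \<mu>] inner_add_left inner_sum_left)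
  then show "lagrangian_grad h g \<delta> x \<mu> = ?G"
    unfolding lagrangian_grad_def by (rule grad_eqI)
  with * show "((\<lambda>y. lagrangian h g \<delta> y \<mu>) has_derivative
      (\<lambda>v. lagrangian_grad h g \<delta> x \<mu> \<bullet> v)) (at x)" by simp
qed

lemma lagrangian_hessian_eq:
  fixes h :: "real^'n \<Rightarrow> real" and g :: "real^'n \<Rightarrow> real^'m"
  assumes h: "twice_cont_diff h" and g: "\<And>c. twice_cont_diff (\<lambda>y. g y $ c)"
  shows "((\<lambda>y. lagrangian_grad h g \<delta> y \<mu>) has_derivative
      (\<lambda>v. lagrangian_hessian h g \<delta> x \<mu> *v v)) (at x)"
    and "lagrangian_hessian h g \<delta> x \<mu>
      = hessian h x + (\<Sum>c\<in>UNIV. \<mu> $ c *\<^sub>R hessian (\<lambda>y. g y $ c) x)"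
proof -
  let ?H = "hessian h x + (\<Sum>c\<in>UNIV. \<mu> $ c *\<^sub>R hessian (\<lambda>y. g y $ c) x)"
  have "((\<lambda>y. grad h y + (\<Sum>c\<in>UNIV. \<mu> $ c *\<^sub>R grad (\<lambda>y. g y $ c) y)) has_derivative
      (\<lambda>v. hessian h x *v v + (\<Sum>c\<in>UNIV. \<mu> $ c *\<^sub>R (hessian (\<lambda>y. g y $ c) x *v v)))) (at x)"
    using h g unfolding twice_cont_diff_def
    by (intro has_derivative_add has_derivative_sum has_derivative_scaleR_right
        has_derivative_hessian) auto
  moreover have "(\<lambda>v. hessian h x *v v + (\<Sum>c\<in>UNIV. \<mu> $ c *\<^sub>R (hessian (\<lambda>y. g y $ c) x *v v)))
      = (\<lambda>v. ?H *v v)"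
  proof
    fix v
    have "(\<Sum>c\<in>C. \<mu> $ c *\<^sub>R (hessian (\<lambda>y. g y $ c) x *v v))
        = (\<Sum>c\<in>C. \<mu> $ c *\<^sub>R hessian (\<lambda>y. g y $ c) x) *v v" for C
      by (induction C rule: infinite_finite_induct)
        (simp_all add: matrix_vector_mult_add_rdistrib scaleR_matrix_vector_assoc)
    then show "hessian h x *v v + (\<Sum>c\<in>UNIV. \<mu> $ c *\<^sub>R (hessian (\<lambda>y. g y $ c) x *v v)) = ?H *v v"
      by (simp add: matrix_vector_mult_add_rdistrib)
  qed
  moreover have "(\<lambda>y. lagrangian_grad h g \<delta> y \<mu>)
      = (\<lambda>y. grad h y + (\<Sum>c\<in>UNIV. \<mu> $ c *\<^sub>R grad (\<lambda>y. g y $ c) y))"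
    using h g by (intro ext lagrangian_grad_eq) (auto simp: twice_cont_diff_def)
  ultimately have *: "((\<lambda>y. lagrangian_grad h g \<delta> y \<mu>) has_derivative (\<lambda>v. ?H *v v)) (at x)"
    by simp
  then show "lagrangian_hessian h g \<delta> x \<mu> = ?H"
    unfolding lagrangian_hessian_def lagrangian_grad_def by (rule hessian_eqI)
  with * show "((\<lambda>y. lagrangian_grad h g \<delta> y \<mu>) has_derivative
      (\<lambda>v. lagrangian_hessian h g \<delta> x \<mu> *v v)) (at x)" by simp
qed

section \<open>Dependence of partial derivatives on single variables\<close>

text \<open>
  If the \<open>j\<close>-th partial derivative does not depend on the \<open>i\<close>-th variable, then the increment of
  \<open>f\<close> in direction \<open>i\<close> has zero derivative in direction \<open>j\<close>. This replaces the symmetry of the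
  second derivative.
\<close>
lemma grad_independent_symmetric:
  fixes f :: "real^'n \<Rightarrow> real"
  assumes f: "\<And>x. f differentiable (at x)"
    and indep: "\<And>x y. (\<forall>l. l \<noteq> i \<longrightarrow> x $ l = y $ l) \<Longrightarrow> grad f x $ j = grad f y $ j"
    and xy: "\<forall>l. l \<noteq> j \<longrightarrow> x $ l = y $ l"
  shows "grad f x $ i = grad f y $ i"
proof -
  let ?i = "axis i 1 :: real^'n" and ?j = "axis j 1 :: real^'n"
  define \<tau> where "\<tau> = x $ j - y $ j"
  have x: "x = y + \<tau> *\<^sub>R ?j"
    using xy by (auto simp: vec_eq_iff \<tau>_def axis_def)
  have line: "((\<lambda>s. f (w + s *\<^sub>R axis l 1)) has_real_derivative grad f (w + s *\<^sub>R axis l 1) $ l) (at s)"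
    for w s l
    using f by (rule axis_line_has_real_derivative)
  \<comment> \<open>Along the lines in direction \<open>i\<close> through \<open>x\<close> and
    through \<open>y\<close>, \<open>f\<close> is the same function up to a constant, so the two
    slopes at \<open>0\<close> agree.\<close>
  have incr: "f (x + s *\<^sub>R ?i) = f (y + s *\<^sub>R ?i) + (f x - f y)" for s
  proof -
    let ?d = "\<lambda>r. f (y + s *\<^sub>R ?i + r *\<^sub>R ?j) - f (y + r *\<^sub>R ?j)"
    have "(?d has_real_derivative 0) (at r)" for r
    proof -
      have "grad f (y + s *\<^sub>R ?i + r *\<^sub>R ?j) $ j = grad f (y + r *\<^sub>R ?j) $ j"
        by (rule indep) (simp add: axis_def)
      then show ?thesis
        using DERIV_diff[OF line[where w = "y + s *\<^sub>R ?i" and l = j and s = r]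
            line[where w = y and l = j and s = r]] by simp
    qed
    then have "?d \<tau> = ?d 0"
      by (intro DERIV_isconst_all) auto
    then show ?thesis
      by (simp add: x algebra_simps)
  qed
  have "((\<lambda>s. f (x + s *\<^sub>R ?i)) has_real_derivative grad f x $ i) (at 0)"
    using line[where w = x and l = i and s = 0] by simp
  moreover have "((\<lambda>s. f (x + s *\<^sub>R ?i)) has_real_derivative grad f y $ i) (at 0)"
    unfolding incr using line[where w = y and l = i and s = 0] by (auto intro!: derivative_eq_intros)
  ultimately show ?thesis
    by (rule DERIV_unique)
qed

text \<open>\<open>x\<close> is turned into \<open>y\<close> by overwriting one coordinate of
  \<open>J\<close> at a time; \<open>J\<close> is finite because the index type is.\<close>

lemma independent_coordinates:
  fixes F :: "real^'n \<Rightarrow> 'a"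
  assumes indep: "\<And>j x y. j \<in> J \<Longrightarrow> (\<forall>l. l \<noteq> j \<longrightarrow> x $ l = y $ l) \<Longrightarrow> F x = F y"
    and "\<forall>l. l \<notin> J \<longrightarrow> x $ l = y $ l"
  shows "F x = F y"
proof -
  have "finite J" by simp
  then show ?thesis using assms
  proof (induction J arbitrary: x rule: finite_induct)
    case empty
    then show ?case by (metis empty_iff vec_eq_iff)
  next
    case (insert j J)
    let ?w = "\<chi> l. if l = j then y $ l else x $ l"
    have "F x = F ?w"
      using insert.prems(1)[of j x ?w] by simp
    also have "\<dots> = F y"
      using insert.prems by (intro insert.IH) auto
    finally show ?case .
  qed
qed

text \<open>\<open>essential_neighbors\<close> asks whether the \<open>j\<close>-th partial
  derivative depends on the \<open>i\<close>-th variable, whereas the update of agent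
  \<open>i\<close> concerns the dependence of the \<open>i\<close>-th partial derivative on the
  \<open>j\<close>-th variable. \<open>grad_independent_symmetric\<close> exchanges the two
  roles.\<close>

lemma lagrangian_grad_essential:
  fixes h :: "real^'n \<Rightarrow> real" and g :: "real^'n \<Rightarrow> real^'m"
  assumes h: "\<And>x. h differentiable (at x)" and g: "\<And>c x. (\<lambda>y. g y $ c) differentiable (at x)"
    and \<mu>: "\<mu> \<in> nonneg_orthant"
    and xy: "\<And>j. j = i \<or> j \<in> essential_neighbors h g \<delta> i \<Longrightarrow> x $ j = y $ j"
  shows "lagrangian_grad h g \<delta> x \<mu> $ i = lagrangian_grad h g \<delta> y \<mu> $ i"
proof (rule independent_coordinates[where F = "\<lambda>x. lagrangian_grad h g \<delta> x \<mu> $ i"])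
  let ?J = "- insert i (essential_neighbors h g \<delta> i)"
  show "\<forall>l. l \<notin> ?J \<longrightarrow> x $ l = y $ l"
    using xy by auto
  fix j and x y :: "real^'n"
  assume j: "j \<in> ?J" and l: "\<forall>l. l \<noteq> j \<longrightarrow> x $ l = y $ l"
  have "(\<lambda>y. lagrangian h g \<delta> y \<mu>) differentiable (at x)" for x
    using lagrangian_grad_eq(1)[OF h g] by (rule differentiableI)
  moreover have "lagrangian_grad h g \<delta> x \<mu> $ j = lagrangian_grad h g \<delta> y \<mu> $ j"
    if "\<forall>l. l \<noteq> i \<longrightarrow> x $ l = y $ l" for x y
    using that j \<mu> unfolding essential_neighbors_def by blast
  ultimately show "lagrangian_grad h g \<delta> x \<mu> $ i = lagrangian_grad h g \<delta> y \<mu> $ i"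
    using l unfolding lagrangian_grad_def by (rule grad_independent_symmetric)
qed

section \<open>Projected gradient steps and optimality conditions\<close>

text \<open>The mean value theorem on the segment from \<open>y\<close> to \<open>x\<close>, applied
  to component \<open>i\<close> alone, brings in row \<open>i\<close> of the Hessian at a single
  intermediate point. The same row of the identity minus \<open>\<gamma>\<close> times this Hessian
  has absolute sum at most \<open>1 - \<gamma> * \<beta>\<close>.\<close>

lemma gradient_step_contraction:
  fixes G :: "real^'n \<Rightarrow> real^'n" and H :: "real^'n \<Rightarrow> real^'n^'n"
  assumes "convex X" "x \<in> X" "y \<in> X" "\<gamma> > 0"
    and G: "\<And>w. w \<in> X \<Longrightarrow> (G has_derivative (\<lambda>v. H w *v v)) (at w)"
    and dom: "\<And>w. w \<in> X \<Longrightarrow> (\<Sum>j\<in>UNIV - {i}. \<bar>H w $ i $ j\<bar>) + \<beta> \<le> H w $ i $ i"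
    and step: "\<And>w. w \<in> X \<Longrightarrow> \<gamma> * H w $ i $ i \<le> 1"
    and e: "\<And>j. \<bar>x $ j - y $ j\<bar> \<le> e"
  shows "\<bar>(x $ i - \<gamma> * G x $ i) - (y $ i - \<gamma> * G y $ i)\<bar> \<le> (1 - \<gamma> * \<beta>) * e"
proof -
  let ?p = "\<lambda>s. G (y + s *\<^sub>R (x - y)) $ i"
  let ?p' = "\<lambda>s. (H (y + s *\<^sub>R (x - y)) *v (x - y)) $ i"
  have seg: "y + s *\<^sub>R (x - y) \<in> X" if "0 \<le> s" "s \<le> 1" for s
  proof -
    have "(1 - s) *\<^sub>R y + s *\<^sub>R x \<in> X"
      using that assms(1-3) by (auto intro: convexD_alt)
    then show ?thesis by (simp add: algebra_simps)
  qed
  have "(?p has_real_derivative ?p' s) (at s)" if "0 \<le> s" "s \<le> 1" for s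
    by (rule line_has_real_derivative)
      (rule bounded_linear.has_derivative[OF bounded_linear_vec_nth G[OF seg[OF that]]])
  then obtain s where s: "0 < s" "s < 1" and "?p 1 - ?p 0 = (1 - 0) * ?p' s"
    using MVT2[of 0 1 ?p ?p'] by auto
  define A where "A = H (y + s *\<^sub>R (x - y)) $ i"
  define v where "v = x - y"
  have ws: "y + s *\<^sub>R (x - y) \<in> X"
    using s seg by auto
  have "G x $ i - G y $ i = (\<Sum>j\<in>UNIV. A $ j * v $ j)"
    using \<open>?p 1 - ?p 0 = _\<close> by (simp add: A_def v_def matrix_vector_mult_def)
  also have "\<dots> = A $ i * v $ i + (\<Sum>j\<in>UNIV - {i}. A $ j * v $ j)"
    by (rule sum.remove) auto
  finally have *: "G x $ i - G y $ i = A $ i * v $ i + (\<Sum>j\<in>UNIV - {i}. A $ j * v $ j)" .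
  have "(x $ i - \<gamma> * G x $ i) - (y $ i - \<gamma> * G y $ i) = v $ i - \<gamma> * (G x $ i - G y $ i)"
    by (simp add: v_def algebra_simps)
  then have "\<bar>(x $ i - \<gamma> * G x $ i) - (y $ i - \<gamma> * G y $ i)\<bar>
      = \<bar>(1 - \<gamma> * A $ i) * v $ i - \<gamma> * (\<Sum>j\<in>UNIV - {i}. A $ j * v $ j)\<bar>"
    unfolding * by (simp only: algebra_simps mult_1_left)
  also have "\<dots> \<le> \<bar>1 - \<gamma> * A $ i\<bar> * \<bar>v $ i\<bar> + \<gamma> * \<bar>\<Sum>j\<in>UNIV - {i}. A $ j * v $ j\<bar>"
    using \<open>\<gamma> > 0\<close> by (intro order_trans[OF abs_triangle_ineq4]) (simp add: abs_mult)
  \<comment> \<open>By \<open>step\<close> the factor \<open>1 - \<gamma> * A $ i\<close> is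
    nonnegative and equals its absolute value.\<close>
  also have "\<dots> \<le> (1 - \<gamma> * A $ i) * e + \<gamma> * ((\<Sum>j\<in>UNIV - {i}. \<bar>A $ j\<bar>) * e)"
  proof (intro add_mono mult_left_mono)
    show "\<bar>1 - \<gamma> * A $ i\<bar> * \<bar>v $ i\<bar> \<le> (1 - \<gamma> * A $ i) * e"
      using step[OF ws] e[of i] by (intro mult_mono) (auto simp: A_def v_def)
    show "\<bar>\<Sum>j\<in>UNIV - {i}. A $ j * v $ j\<bar> \<le> (\<Sum>j\<in>UNIV - {i}. \<bar>A $ j\<bar>) * e"
      unfolding sum_distrib_right using e
      by (intro order_trans[OF sum_abs] sum_mono) (auto simp: abs_mult v_def intro!: mult_left_mono)
  qed (use \<open>\<gamma> > 0\<close> in auto)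
  also have "\<dots> = (1 - \<gamma> * (A $ i - (\<Sum>j\<in>UNIV - {i}. \<bar>A $ j\<bar>))) * e"
    by (simp add: algebra_simps)
  also have "\<dots> \<le> (1 - \<gamma> * \<beta>) * e"
    using dom[OF ws] \<open>\<gamma> > 0\<close> e[of i] by (intro mult_right_mono) (auto simp: A_def)
  finally show ?thesis .
qed

text \<open>In the expansion of the squared distance from \<open>u - \<gamma> * G\<close> to
  \<open>y\<close>, the variational inequality leaves only nonnegative terms beyond the squared
  distance to \<open>u\<close>.\<close>

lemma closest_point_gradient_step:
  fixes S :: "real set"
  assumes "convex S" "closed S" "u \<in> S" "\<gamma> > 0" "\<And>y. y \<in> S \<Longrightarrow> 0 \<le> G * (y - u)"
  shows "closest_point S (u - \<gamma> * G) = u"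
proof (rule closest_point_unique[symmetric, OF assms(1-3)], rule ballI)
  fix y assume "y \<in> S"
  have "\<bar>\<gamma> * G\<bar>\<^sup>2 \<le> \<bar>u - \<gamma> * G - y\<bar>\<^sup>2"
  proof -
    have "(u - \<gamma> * G - y)\<^sup>2 = (\<gamma> * G)\<^sup>2 + (y - u)\<^sup>2 + 2 * (\<gamma> * (G * (y - u)))"
      by (simp add: power2_eq_square algebra_simps)
    moreover have "0 \<le> \<gamma> * (G * (y - u))"
      using assms(4) assms(5)[OF \<open>y \<in> S\<close>] by simp
    ultimately show ?thesis
      using zero_le_power2[of "y - u"] unfolding power2_abs by linarith
  qed
  then show "dist (u - \<gamma> * G) u \<le> dist (u - \<gamma> * G) y"
    by (simp add: dist_real_def abs_le_square_iff)
qed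

text \<open>The product structure of \<open>X\<close> permits moving coordinate \<open>i\<close>
  alone from \<open>u $ i\<close> to \<open>a\<close>; a negative slope in that direction would
  contradict minimality.\<close>

lemma box_minimizer_gradient:
  fixes f :: "real^'n \<Rightarrow> real"
  assumes X: "X = {y. \<forall>i. y $ i \<in> Xs i}" and "convex X"
    and u: "u \<in> X" "\<And>y. y \<in> X \<Longrightarrow> f u \<le> f y"
    and f: "(f has_derivative (\<lambda>v. G \<bullet> v)) (at u)" and "a \<in> Xs i"
  shows "0 \<le> G $ i * (a - u $ i)"
proof -
  define v :: "real^'n" where "v = (a - u $ i) *\<^sub>R axis i 1"
  have "u + v \<in> X"
    using u(1) \<open>a \<in> Xs i\<close> by (auto simp: X v_def axis_def)
  have seg: "u + s *\<^sub>R v \<in> X" if "0 \<le> s" "s \<le> 1" for s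
  proof -
    have "(1 - s) *\<^sub>R u + s *\<^sub>R (u + v) \<in> X"
      using that \<open>u + v \<in> X\<close> u(1) \<open>convex X\<close> by (auto intro: convexD_alt)
    then show ?thesis by (simp add: algebra_simps)
  qed
  have d: "((\<lambda>s. f (u + s *\<^sub>R v)) has_real_derivative G \<bullet> v) (at 0)"
    by (rule line_has_real_derivative) (use f in simp)
  have "0 \<le> G \<bullet> v"
  proof (rule ccontr)
    assume "\<not> 0 \<le> G \<bullet> v"
    then obtain \<epsilon> where "\<epsilon> > 0"
      and \<epsilon>: "\<And>s. 0 < s \<Longrightarrow> s < \<epsilon> \<Longrightarrow> f (u + s *\<^sub>R v) < f u"
      using DERIV_neg_dec_right[OF d] by auto
    \<comment> \<open>Less than \<open>\<epsilon>\<close>, for the strict decrease, and at most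
      \<open>1\<close>, so that the point stays on the segment inside \<open>X\<close>.\<close>
    define s where "s = min 1 (\<epsilon> / 2)"
    have "f (u + s *\<^sub>R v) < f u"
      using \<open>\<epsilon> > 0\<close> by (intro \<epsilon>) (auto simp: s_def)
    moreover have "f u \<le> f (u + s *\<^sub>R v)"
      using \<open>\<epsilon> > 0\<close> by (intro u seg) (auto simp: s_def)
    ultimately show False by simp
  qed
  then show ?thesis
    by (simp add: v_def inner_axis mult.commute)
qed

section \<open>Slater bound for the saddle multiplier\<close>

text \<open>Testing the saddle inequalities with the multiplier \<open>0\<close> and the point
  \<open>xbar\<close> gives \<open>h xhat \<le> h xbar + muhat \<bullet> g xbar\<close>; the
  smallest slack \<open>m\<close> at \<open>xbar\<close> then controls the l1-norm of
  \<open>muhat\<close>.\<close>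

lemma saddle_multiplier_in_dual_set:
  fixes h :: "real^'n \<Rightarrow> real" and g :: "real^'n \<Rightarrow> real^'m"
  assumes "\<delta> > 0" and slater: "slater_point g X xbar"
    and saddle: "is_saddle_point (lagrangian h g \<delta>) X nonneg_orthant xhat muhat"
    and bdd: "bdd_below (h ` X)"
  shows "muhat \<in> dual_set (dual_bound h g X xbar)"
proof -
  define m where "m = Min (range (\<lambda>j. - (g xbar $ j)))"
  have xbar: "xbar \<in> X" and "m > 0"
    using slater by (auto simp: slater_point_def m_def)
  have m: "m \<le> - (g xbar $ j)" for j
    unfolding m_def by (rule Min_le) auto
  have xhat: "xhat \<in> X" and muhat: "muhat \<in> nonneg_orthant"
    and max: "\<And>\<mu>. \<mu> \<in> nonneg_orthant \<Longrightarrow> lagrangian h g \<delta> xhat \<mu> \<le> lagrangian h g \<delta> xhat muhat"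
    and min: "\<And>x. x \<in> X \<Longrightarrow> lagrangian h g \<delta> xhat muhat \<le> lagrangian h g \<delta> x muhat"
    using saddle by (auto simp: is_saddle_point_def)
  have "(\<Sum>c\<in>UNIV. \<bar>muhat $ c\<bar>) * m \<le> (\<Sum>c\<in>UNIV. muhat $ c * - (g xbar $ c))"
    unfolding sum_distrib_right
  proof (rule sum_mono)
    fix c
    have "0 \<le> muhat $ c"
      using muhat by (simp add: nonneg_orthant_def)
    with mult_left_mono[OF m this] show "\<bar>muhat $ c\<bar> * m \<le> muhat $ c * - (g xbar $ c)"
      by simp
  qed
  also have "\<dots> = - (muhat \<bullet> g xbar)"
    by (simp add: inner_vec_def sum_negf)
  also have "\<dots> \<le> h xbar - h xhat"
  proof -
    have "h xhat \<le> lagrangian h g \<delta> xhat muhat"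
      using max[of 0] by (simp add: nonneg_orthant_def lagrangian_def)
    also have "\<dots> \<le> lagrangian h g \<delta> xbar muhat"
      by (rule min[OF xbar])
    also have "\<dots> \<le> h xbar + muhat \<bullet> g xbar"
      using \<open>\<delta> > 0\<close> by (simp add: lagrangian_def)
    finally show ?thesis by simp
  qed
  also have "\<dots> \<le> h xbar - (INF x\<in>X. h x)"
    using cINF_lower[OF bdd xhat] by simp
  finally show ?thesis
    using \<open>m > 0\<close> muhat by (simp add: dual_set_def dual_bound_def m_def[symmetric] le_divide_eq)
qed

section \<open>Error propagation through completed rounds\<close>

text \<open>
  While the counter is \<open>r\<close>, every copy in use since the last increment is within \<open>E r\<close>. So every
  value computed since then is within \<open>E (Suc r)\<close>, and a completed round replaces all the copies
  by such values.
\<close>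
lemma async_error_bound:
  fixes x :: "'n::finite \<Rightarrow> nat \<Rightarrow> real^'n" and t :: "nat \<Rightarrow> 'm \<Rightarrow> nat" and E :: "nat \<Rightarrow> real"
  assumes t: "\<And>k. t k \<le> t (Suc k)"
    and idle: "\<And>i k. k \<notin> K i \<Longrightarrow> x i (Suc k) $ i = x i k $ i"
    and recv: "\<And>i j k \<kappa>. j \<in> N i \<Longrightarrow> receives K S t i j k \<kappa> \<Longrightarrow> x i (Suc k) $ j = x j (Suc \<kappa>) $ j"
    and keep: "\<And>i j k. j \<in> N i \<Longrightarrow> \<nexists>\<kappa>. receives K S t i j k \<kappa> \<Longrightarrow> x i (Suc k) $ j = x i k $ j"
    and step: "\<And>i k r. k \<in> K i \<Longrightarrow> t k = T
      \<Longrightarrow> (\<And>j. j = i \<or> j \<in> N i \<Longrightarrow> \<bar>x i k $ j - u $ j\<bar> \<le> E r)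
      \<Longrightarrow> \<bar>x i (Suc k) $ i - u $ i\<bar> \<le> E (Suc r)"
    and E: "\<And>r. E (Suc r) \<le> E r"
    and start: "\<And>i k j. \<bar>x i k $ j - u $ j\<bar> \<le> E 0"
    and "onboard t k T" "j = i \<or> j \<in> N i"
  shows "\<bar>x i k $ j - u $ j\<bar> \<le> E (ops N K S t k T)"
proof -
  let ?st = "ops_state N K S t T"
  have mono: "t a \<le> t b" if "a \<le> b" for a b
    using t that by (rule lift_Suc_mono_le)
  \<comment> \<open>After iteration \<open>\<kappa>\<close> agent \<open>j\<close> computes nothing
    more before time \<open>s\<close>. So an accepted message carries the entry that its sender
    holds when sending it.\<close>
  have own: "x j s $ j = x j (Suc \<kappa>) $ j" if "computed_in K j s \<kappa>" for j s \<kappa>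
  proof -
    have "Suc \<kappa> \<le> s" using that by (simp add: computed_in_def)
    have "x j s' $ j = x j (Suc \<kappa>) $ j" if "Suc \<kappa> \<le> s'" "s' \<le> s" for s'
      using that
    proof (induction s' rule: dec_induct)
      case (step r)
      with \<open>computed_in K j s \<kappa>\<close> have "r \<notin> K j" by (auto simp: computed_in_def)
      with step show ?case by (simp add: idle)
    qed simp
    with \<open>Suc \<kappa> \<le> s\<close> show ?thesis by blast
  qed
  have neigh: "x i (Suc s) $ j = x j s $ j \<or> x i (Suc s) $ j = x i s $ j" if "j \<in> N i" for i j s
    using recv[OF that, of s] keep[OF that, of s] own by (metis receives_def)
  define near where
    "near r s \<longleftrightarrow> (\<forall>i j. j = i \<or> j \<in> N i \<longrightarrow> \<bar>x i s $ j - u $ j\<bar> \<le> E r)" for r s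
  have near_step: "\<bar>x i (Suc s) $ i - u $ i\<bar> \<le> E (Suc r)" if "s \<in> K i" "t s = T" "near r s" for i s r
    using that by (intro step) (auto simp: near_def)
  have fresh: "?st k = (0, 0)" if "\<And>s. s < k \<Longrightarrow> t s \<noteq> T" for k
    using that by (induction k) (auto simp: round_complete_def less_Suc_eq)
  have last_le: "snd (?st k) \<le> k" for k
    by (induction k) (auto simp: Let_def split: prod.split)
  \<comment> \<open>The invariant covers all times since the last increment, because a round may use
    updates computed at any of them.\<close>
  have inv: "\<forall>s. snd (?st k) \<le> s \<and> s \<le> k \<longrightarrow> near (fst (?st k)) s" if "onboard t k T" for k
    using that
  proof (induction k)
    case 0
    then show ?case using start by (auto simp: near_def)
  next
    case (Suc k)
    show ?case
    proof (cases "T = t k")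
      \<comment> \<open>Here \<open>T\<close> arrives at time \<open>Suc k\<close>. The clock is
        monotone, so \<open>T\<close> was never onboard earlier and the count still has its initial
        value.\<close>
      case False
      have "t s \<noteq> T" if "s < Suc k" for s
      proof
        assume "t s = T"
        with Suc.prems False have "T = t (Suc k)" by (auto simp: onboard_def)
        with \<open>t s = T\<close> that mono[of s k] t[of k] have "t k = T"
          by (simp add: order_antisym)
        with False show False by simp
      qed
      from fresh[OF this] show ?thesis using start by (simp add: near_def del: ops_state.simps)
    next
      case True
      obtain r l where st: "?st k = (r, l)" by (cases "?st k")
      have near: "near r s" if "l \<le> s" "s \<le> k" for s
        using Suc.IH True st that by (simp add: onboard_def)
      have "l \<le> k"
        using last_le[of k] st by simp
      have shrink: "\<bar>a\<bar> \<le> E r" if "\<bar>a\<bar> \<le> E (Suc r)" for a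
        using that E[of r] by simp
      \<comment> \<open>An entry at time \<open>Suc k\<close> is either a new update, within
        \<open>E (Suc r) \<le> E r\<close>, or was already present in some agent at time
        \<open>k\<close>.\<close>
      have near': "near r s" if "l \<le> s" "s \<le> Suc k" for s
      proof (cases "s \<le> k")
        case False
        with that have s: "s = Suc k" by simp
        have own_k: "\<bar>x i k $ i - u $ i\<bar> \<le> E r" for i
          using near[OF \<open>l \<le> k\<close>] by (simp add: near_def)
        have "\<bar>x i (Suc k) $ i - u $ i\<bar> \<le> E r" for i
          using near_step[OF _ True[symmetric] near[OF \<open>l \<le> k\<close>], of i] shrink idle[of k i] own_k[of i]
          by (cases "k \<in> K i") auto
        moreover have "\<bar>x i (Suc k) $ j - u $ j\<bar> \<le> E r" if "j \<in> N i" for i j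
          using neigh[OF that, of k] own_k[of j] near[OF \<open>l \<le> k\<close>] that
          by (auto simp: near_def)
        ultimately show ?thesis by (auto simp: near_def s)
      qed (use near that in simp)
      have "near (Suc r) (Suc k)" if "round_complete N K S t T l (Suc k)"
      proof -
        have "\<forall>j. \<exists>\<kappa>. \<kappa> \<in> K j \<and> l \<le> \<kappa> \<and> \<kappa> \<le> k \<and> t \<kappa> = T \<and>
            (\<forall>i. j \<in> N i \<longrightarrow> (\<exists>q\<le>k. receives K S t i j q \<kappa>))"
          using that by (auto simp: round_complete_def less_Suc_eq_le Bex_def)
        then obtain \<kappa> where \<kappa>: "\<kappa> j \<in> K j" "l \<le> \<kappa> j" "\<kappa> j \<le> k" "t (\<kappa> j) = T"
          and sent: "j \<in> N i \<Longrightarrow> \<exists>q\<le>k. receives K S t i j q (\<kappa> j)" for i j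
          by metis
        \<comment> \<open>Later computations of \<open>j\<close> up to iteration \<open>k\<close>
          use the same \<open>T\<close>, since the clock is monotone and equals \<open>T\<close>
          both at \<open>\<kappa> j\<close> and at \<open>k\<close>. They therefore preserve the
          improved bound.\<close>
        have own_new: "\<bar>x j s $ j - u $ j\<bar> \<le> E (Suc r)" if "Suc (\<kappa> j) \<le> s" "s \<le> Suc k" for j s
          using that
        proof (induction s rule: dec_induct)
          case base
          show ?case using \<kappa> by (intro near_step near) auto
        next
          case (step s)
          have "t s = T"
            using mono[of "\<kappa> j" s] mono[of s k] step \<kappa>(4)[of j] True by (simp add: order_antisym)
          moreover have "near r s"
            using step \<kappa>(2)[of j] by (intro near) auto
          ultimately show ?case
            using near_step[of s j r] idle[of s j] step by (cases "s \<in> K j") auto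
        qed
        have "\<bar>x i (Suc k) $ j - u $ j\<bar> \<le> E (Suc r)" if "j \<in> N i" for i j
        proof -
          obtain q where q: "q \<le> k" "receives K S t i j q (\<kappa> j)"
            using sent[OF \<open>j \<in> N i\<close>] by blast
          have "\<kappa> j < q"
            using q by (simp add: receives_def computed_in_def)
          \<comment> \<open>Any message after the receipt is sent later than
            \<open>\<kappa> j\<close> and carries an entry covered by \<open>own_new\<close>; it
            cannot bring back an older value.\<close>
          have "\<bar>x i s $ j - u $ j\<bar> \<le> E (Suc r)" if "Suc q \<le> s" "s \<le> Suc k" for s
            using that
          proof (induction s rule: dec_induct)
            case base
            show ?case
              using recv[OF \<open>j \<in> N i\<close> q(2)] own_new[of j "Suc (\<kappa> j)"] \<kappa>(3)[of j] by simp
          next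
            case (step s)
            then show ?case
              using neigh[OF \<open>j \<in> N i\<close>, of s] own_new[of j s] \<open>\<kappa> j < q\<close> by auto
          qed
          with q show ?thesis by simp
        qed
        moreover have "\<bar>x i (Suc k) $ i - u $ i\<bar> \<le> E (Suc r)" for i
          using own_new[of i "Suc k"] \<kappa>(3)[of i] by simp
        ultimately show ?thesis by (auto simp: near_def)
      qed
      with near' st show ?thesis by (auto simp: Let_def)
    qed
  qed
  from inv[OF assms(8)] last_le[of k] have "near (fst (?st k)) k" by blast
  with assms(9) show ?thesis unfolding near_def ops_def by blast
qed

section \<open>Bounds on the Hessian and gradient of the Lagrangian\<close>

lemma hessian_entries_bounded:
  fixes f :: "real^'n \<Rightarrow> real"
  assumes "twice_cont_diff f" "compact X"
  obtains A where "\<And>x i j. x \<in> X \<Longrightarrow> \<bar>hessian f x $ i $ j\<bar> \<le> A"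
proof -
  have "compact (hessian f ` X)"
    using assms by (intro compact_continuous_image)
      (auto simp: twice_cont_diff_def intro: continuous_on_subset)
  then obtain A where "\<And>x. x \<in> X \<Longrightarrow> norm (hessian f x) \<le> A"
    by (meson compact_imp_bounded bounded_iff imageI)
  then have "\<bar>hessian f x $ i $ j\<bar> \<le> A" if "x \<in> X" for x i j
    using that component_le_norm_cart[of "hessian f x $ i" j]
      Finite_Cartesian_Product.norm_nth_le[of "hessian f x" i] by force
  then show ?thesis by (rule that)
qed

text \<open>The Hessian is affine in \<open>\<mu>\<close>, and its finitely many coefficient
  matrices are continuous, hence have uniformly bounded entries on the compact set
  \<open>X\<close>.\<close>

lemma lagrangian_hessian_lipschitz:
  fixes h :: "real^'n \<Rightarrow> real" and g :: "real^'n \<Rightarrow> real^'m"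
  assumes h: "twice_cont_diff h" and g: "\<And>c. twice_cont_diff (\<lambda>y. g y $ c)" and X: "compact X"
  obtains A where "A > 0"
    and "\<And>x \<mu> i j. x \<in> X \<Longrightarrow> \<bar>lagrangian_hessian h g \<delta> x \<mu> $ i $ j\<bar> \<le> A + A * (\<Sum>c\<in>UNIV. \<bar>\<mu> $ c\<bar>)"
    and "\<And>x \<mu> \<nu> i j. x \<in> X \<Longrightarrow> \<bar>lagrangian_hessian h g \<delta> x \<mu> $ i $ j
      - lagrangian_hessian h g \<delta> x \<nu> $ i $ j\<bar> \<le> A * (\<Sum>c\<in>UNIV. \<bar>\<mu> $ c - \<nu> $ c\<bar>)"
proof -
  obtain A0 where A0: "\<And>x i j. x \<in> X \<Longrightarrow> \<bar>hessian h x $ i $ j\<bar> \<le> A0"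
    using hessian_entries_bounded[OF h X] by blast
  have "\<forall>c. \<exists>A. \<forall>x\<in>X. \<forall>i j. \<bar>hessian (\<lambda>y. g y $ c) x $ i $ j\<bar> \<le> A"
    using hessian_entries_bounded[OF g X] by metis
  then obtain A1 where A1: "\<And>c x i j. x \<in> X \<Longrightarrow> \<bar>hessian (\<lambda>y. g y $ c) x $ i $ j\<bar> \<le> A1 c"
    by metis
  \<comment> \<open>A common bound for the Hessians of the objective and of all constraints; the
    summand \<open>1\<close> makes it positive even if they all vanish.\<close>
  define A where "A = 1 + \<bar>A0\<bar> + (\<Sum>c\<in>UNIV. \<bar>A1 c\<bar>)"
  have "\<bar>A1 c\<bar> \<le> (\<Sum>c\<in>UNIV. \<bar>A1 c\<bar>)" for c
    by (rule member_le_sum) auto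
  then have "A1 c \<le> A" for c
    unfolding A_def by (smt (verit, best))
  moreover have "A0 \<le> A"
    using sum_nonneg[of UNIV "\<lambda>c. \<bar>A1 c\<bar>"] unfolding A_def by (smt (verit, best))
  ultimately have A_h: "\<bar>hessian h x $ i $ j\<bar> \<le> A"
    and A_g: "\<bar>hessian (\<lambda>y. g y $ c) x $ i $ j\<bar> \<le> A" if "x \<in> X" for x i j c
    using A0[OF that] A1[OF that] by (meson order_trans)+
  have H: "lagrangian_hessian h g \<delta> x \<mu> $ i $ j
      = hessian h x $ i $ j + (\<Sum>c\<in>UNIV. \<mu> $ c * hessian (\<lambda>y. g y $ c) x $ i $ j)" for x \<mu> i j
    by (simp add: lagrangian_hessian_eq(2)[OF h g])
  have sum_le: "\<bar>\<Sum>c\<in>UNIV. a c * hessian (\<lambda>y. g y $ c) x $ i $ j\<bar> \<le> A * (\<Sum>c\<in>UNIV. \<bar>a c\<bar>)"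
    if "x \<in> X" for a x i j
    unfolding sum_distrib_left using A_g[OF that]
    by (intro order_trans[OF sum_abs] sum_mono) (auto simp: abs_mult mult.commute[of A] intro!: mult_left_mono)
  show ?thesis
  proof (rule that[of A])
    show "A > 0"
      by (simp add: A_def sum_nonneg add_pos_nonneg)
    show "\<bar>lagrangian_hessian h g \<delta> x \<mu> $ i $ j\<bar> \<le> A + A * (\<Sum>c\<in>UNIV. \<bar>\<mu> $ c\<bar>)"
      if "x \<in> X" for x \<mu> i j
      unfolding H using A_h[OF that] sum_le[OF that] by (intro order_trans[OF abs_triangle_ineq] add_mono)
    show "\<bar>lagrangian_hessian h g \<delta> x \<mu> $ i $ j - lagrangian_hessian h g \<delta> x \<nu> $ i $ j\<bar>
        \<le> A * (\<Sum>c\<in>UNIV. \<bar>\<mu> $ c - \<nu> $ c\<bar>)" if "x \<in> X" for x \<mu> \<nu> i j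
      using sum_le[OF that, of "\<lambda>c. \<mu> $ c - \<nu> $ c" i j]
      by (simp add: H sum_subtractf[symmetric] left_diff_distrib)
  qed
qed

text \<open>
  The dual iterates are projected onto \<open>[0,B]\<close> componentwise and can leave the set over which
  \<open>\<gamma>\<close> is chosen. Since the bound on \<open>\<gamma>\<close> is strict, the step size is still admissible near each
  point of that set.
\<close>
lemma step_size_admissible_near:
  fixes h :: "real^'n \<Rightarrow> real" and g :: "real^'n \<Rightarrow> real^'m"
  assumes h: "twice_cont_diff h" and g: "\<And>c. twice_cont_diff (\<lambda>y. g y $ c)" and X: "compact X"
    and \<gamma>: "\<gamma> > 0" "\<gamma> < 1 / max_row_sum h g \<delta> X (dual_set B)" and \<nu>: "\<nu> \<in> dual_set B"
  obtains \<epsilon> where "\<epsilon> > 0"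
    and "\<And>x \<mu> i. x \<in> X \<Longrightarrow> norm (\<mu> - \<nu>) \<le> \<epsilon> \<Longrightarrow> \<gamma> * \<bar>lagrangian_hessian h g \<delta> x \<mu> $ i $ i\<bar> \<le> 1"
proof -
  let ?H = "lagrangian_hessian h g \<delta>" and ?M = "dual_set B :: (real^'m) set"
  obtain A where A: "A > 0"
    and bound: "\<And>x \<mu> i j. x \<in> X \<Longrightarrow> \<bar>?H x \<mu> $ i $ j\<bar> \<le> A + A * (\<Sum>c\<in>UNIV. \<bar>\<mu> $ c\<bar>)"
    and lip: "\<And>x \<mu> \<nu> i j. x \<in> X
      \<Longrightarrow> \<bar>?H x \<mu> $ i $ j - ?H x \<nu> $ i $ j\<bar> \<le> A * (\<Sum>c\<in>UNIV. \<bar>\<mu> $ c - \<nu> $ c\<bar>)"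
    by (rule lagrangian_hessian_lipschitz[OF h g X, where \<delta> = \<delta>]) (rule that)
  define R where "R = max_row_sum h g \<delta> X ?M"
  \<comment> \<open>Boundedness is what makes the supremum in \<open>max_row_sum\<close> an upper
    bound of the row sums.\<close>
  have "bdd_above ((\<lambda>(i, x, \<mu>). \<Sum>j\<in>UNIV. \<bar>?H x \<mu> $ i $ j\<bar>) ` (UNIV \<times> X \<times> ?M))"
  proof (rule bdd_aboveI2, clarify)
    fix i x and \<mu> :: "real^'m" assume x: "x \<in> X" and \<mu>: "\<mu> \<in> ?M"
    have "\<bar>?H x \<mu> $ i $ j\<bar> \<le> A + A * B" for j
      using bound[OF x, of \<mu> i j] \<mu> A by (auto simp: dual_set_def elim!: order_trans)
    then show "(\<Sum>j\<in>UNIV. \<bar>?H x \<mu> $ i $ j\<bar>) \<le> (\<Sum>j\<in>(UNIV :: 'n set). A + A * B)"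
      by (intro sum_mono)
  qed
  then have "(\<Sum>j\<in>UNIV. \<bar>?H x \<nu> $ i $ j\<bar>) \<le> R" if "x \<in> X" for x i
    unfolding R_def max_row_sum_def using that \<nu> by (intro cSUP_upper2[where x = "(i, x, \<nu>)"]) auto
  moreover have "\<bar>?H x \<nu> $ i $ i\<bar> \<le> (\<Sum>j\<in>UNIV. \<bar>?H x \<nu> $ i $ j\<bar>)" for x i
    by (rule member_le_sum) auto
  ultimately have R: "\<bar>?H x \<nu> $ i $ i\<bar> \<le> R" if "x \<in> X" for x i
    using that order_trans by blast
  \<comment> \<open>For \<open>R \<le> 0\<close> the quotient \<open>1 / R\<close> is at most
    \<open>0\<close> (at \<open>R = 0\<close> by the convention for division), which contradicts
    \<open>0 < \<gamma> < 1 / R\<close>.\<close>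
  have "R > 0"
    using \<gamma> by (smt (verit) R_def divide_nonneg_nonpos)
  then have "\<gamma> * R < 1"
    using \<gamma> by (simp add: R_def less_divide_eq)
  \<comment> \<open>The solution of
    \<open>\<gamma> * (R + A * (real CARD('m) * \<epsilon>)) = 1\<close>; the factor
    \<open>real CARD('m)\<close> is the price of passing from the norm to the sum of the
    entries.\<close>
  define \<epsilon> where "\<epsilon> = (1 - \<gamma> * R) / (\<gamma> * A * real CARD('m))"
  show ?thesis
  proof (rule that[of \<epsilon>])
    show "\<epsilon> > 0"
      using \<open>\<gamma> * R < 1\<close> \<gamma> A by (simp add: \<epsilon>_def)
    fix x i and \<mu> :: "real^'m" assume x: "x \<in> X" and \<mu>: "norm (\<mu> - \<nu>) \<le> \<epsilon>"
    have "\<bar>\<mu> $ c - \<nu> $ c\<bar> \<le> \<epsilon>" for c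
      using component_le_norm_cart[of "\<mu> - \<nu>" c] \<mu> by simp
    then have "(\<Sum>c\<in>UNIV. \<bar>\<mu> $ c - \<nu> $ c\<bar>) \<le> real CARD('m) * \<epsilon>"
      using sum_bounded_above[of UNIV "\<lambda>c. \<bar>\<mu> $ c - \<nu> $ c\<bar>" \<epsilon>] by simp
    then have "\<bar>?H x \<mu> $ i $ i - ?H x \<nu> $ i $ i\<bar> \<le> A * (real CARD('m) * \<epsilon>)"
      using lip[OF x, of \<mu> i i \<nu>] A by (meson mult_left_mono less_imp_le order_trans)
    then have "\<bar>?H x \<mu> $ i $ i\<bar> \<le> R + A * (real CARD('m) * \<epsilon>)"
      using R[OF x, of i] by linarith
    then have "\<gamma> * \<bar>?H x \<mu> $ i $ i\<bar> \<le> \<gamma> * (R + A * (real CARD('m) * \<epsilon>))"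
      using \<gamma> by (intro mult_left_mono) auto
    also have "\<dots> = 1"
      using \<gamma> A by (simp add: \<epsilon>_def field_simps)
    finally show "\<gamma> * \<bar>?H x \<mu> $ i $ i\<bar> \<le> 1" .
  qed
qed

text \<open>The difference is linear in \<open>\<mu> - \<nu>\<close>, with the constraint gradients
  at \<open>x\<close> as coefficients. It is applied at the fixed point \<open>xhat\<close>, so a
  constant depending on \<open>x\<close> suffices.\<close>

lemma lagrangian_grad_lipschitz:
  fixes h :: "real^'n \<Rightarrow> real" and g :: "real^'n \<Rightarrow> real^'m"
  assumes "h differentiable (at x)" "\<And>c. (\<lambda>y. g y $ c) differentiable (at x)"
  shows "\<bar>lagrangian_grad h g \<delta> x \<mu> $ i - lagrangian_grad h g \<delta> x \<nu> $ i\<bar>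
    \<le> (\<Sum>c\<in>UNIV. norm (grad (\<lambda>y. g y $ c) x)) * norm (\<mu> - \<nu>)"
proof -
  have "\<bar>lagrangian_grad h g \<delta> x \<mu> $ i - lagrangian_grad h g \<delta> x \<nu> $ i\<bar>
      = \<bar>\<Sum>c\<in>UNIV. grad (\<lambda>y. g y $ c) x $ i * (\<mu> $ c - \<nu> $ c)\<bar>"
    by (simp add: lagrangian_grad_eq(2)[OF assms] sum_subtractf[symmetric] algebra_simps)
  also have "\<dots> \<le> (\<Sum>c\<in>UNIV. norm (grad (\<lambda>y. g y $ c) x) * norm (\<mu> - \<nu>))"
    using component_le_norm_cart component_le_norm_cart[of "\<mu> - \<nu>"]
    by (intro order_trans[OF sum_abs] sum_mono) (auto simp: abs_mult intro!: mult_mono)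
  finally show ?thesis
    by (simp add: sum_distrib_right)
qed

text \<open>Nonnegative multipliers give a nonnegative combination of Hessians of convex functions.
  Thus the absolute value around the diagonal entry in \<open>diag_dominant\<close> can be
  removed.\<close>

lemma lagrangian_hessian_diagonal_nonneg:
  fixes h :: "real^'n \<Rightarrow> real" and g :: "real^'n \<Rightarrow> real^'m"
  assumes h: "twice_cont_diff h" "convex_on UNIV h"
    and g: "\<And>c. twice_cont_diff (\<lambda>y. g y $ c)" "\<And>c. convex_on UNIV (\<lambda>y. g y $ c)"
    and \<mu>: "\<mu> \<in> nonneg_orthant"
  shows "0 \<le> lagrangian_hessian h g \<delta> x \<mu> $ i $ i"
proof -
  have "0 \<le> hessian h x $ i $ i" "0 \<le> hessian (\<lambda>y. g y $ c) x $ i $ i" for c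
    using h g by (auto simp: twice_cont_diff_def intro!: convex_hessian_diagonal_nonneg)
  then show ?thesis
    using \<mu> by (auto simp: lagrangian_hessian_eq(2)[OF h(1) g(1)] nonneg_orthant_def
        intro!: add_nonneg_nonneg sum_nonneg)
qed

section \<open>Feasibility and message passing along a run\<close>

text \<open>One coordinate of a point of \<open>X\<close> can be replaced by any element of its
  factor. So \<open>Xs i\<close> is the image of \<open>X\<close> under the \<open>i\<close>-th
  projection and inherits its properties.\<close>

lemma box_factors:
  fixes X :: "(real^'n) set"
  assumes X: "X = {y. \<forall>i. y $ i \<in> Xs i}" and "X \<noteq> {}" "compact X" "convex X"
  shows "Xs i \<noteq> {}" "closed (Xs i)" "convex (Xs i)"
proof -
  obtain u where u: "\<And>i. u $ i \<in> Xs i"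
    using X \<open>X \<noteq> {}\<close> by blast
  have "Xs i = (\<lambda>y. y $ i) ` X"
  proof
    show "Xs i \<subseteq> (\<lambda>y. y $ i) ` X"
    proof
      fix a assume "a \<in> Xs i"
      then have "(\<chi> l. if l = i then a else u $ l) \<in> X"
        using u by (simp add: X)
      then show "a \<in> (\<lambda>y. y $ i) ` X"
        by (rule rev_image_eqI) simp
    qed
  qed (auto simp: X)
  moreover have "compact ((\<lambda>y. y $ i) ` X)"
    using \<open>compact X\<close> by (intro compact_continuous_image continuous_intros)
  moreover have "convex ((\<lambda>y. y $ i) ` X)"
    using \<open>convex X\<close> by (intro convex_linear_image bounded_linear.linear bounded_linear_vec_nth)
  ultimately show "Xs i \<noteq> {}" "closed (Xs i)" "convex (Xs i)"
    using \<open>X \<noteq> {}\<close> by (auto intro: compact_imp_closed)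
qed

text \<open>The existence of \<open>\<mu>0\<close> forces \<open>B \<ge> 0\<close>, so the interval
  \<open>{0..B}\<close> is nonempty and projections land in it. The orthant is where diagonal
  dominance is available.\<close>

lemma async_dual_iterate_nonneg:
  fixes \<mu>0 :: "real^'m"
  assumes run: "async_primal_dual h g \<delta> Xs B \<gamma> \<rho> x0 \<mu>0 K S D x t \<mu> z" and \<mu>0: "\<mu>0 \<in> dual_set B"
  shows "dual_vector \<mu> (t k) \<in> nonneg_orthant"
proof -
  have "0 \<le> (\<Sum>c\<in>UNIV. \<bar>\<mu>0 $ c\<bar>)"
    by (rule sum_nonneg) simp
  also have "\<dots> \<le> B"
    using \<mu>0 by (simp add: dual_set_def)
  finally have "B \<ge> 0" .
  have "0 \<le> \<mu> c (t k c)" for c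
  proof (induction k)
    case 0
    then show ?case
      using run \<mu>0 by (auto simp: async_primal_dual_def dual_set_def nonneg_orthant_def)
  next
    case (Suc k)
    show ?case
    proof (cases "dual_updates K D t c k")
      case True
      have "closest_point {0..B} a \<in> {0..B}" for a
        using \<open>B \<ge> 0\<close> by (intro closest_point_in_set) auto
      with True run show ?thesis by (simp add: async_primal_dual_def)
    next
      case False
      with Suc run show ?thesis by (simp add: async_primal_dual_def)
    qed
  qed
  then show ?thesis
    by (simp add: nonneg_orthant_def dual_vector_def)
qed

lemma async_dual_clock_mono:
  assumes "async_primal_dual h g \<delta> Xs B \<gamma> \<rho> x0 \<mu>0 K S D x t \<mu> z"
  shows "t k \<le> t (Suc k)"
proof (rule le_funI)
  fix c
  show "t k c \<le> t (Suc k) c"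
    using assms by (cases "dual_updates K D t c k") (simp_all add: async_primal_dual_def)
qed

lemma async_neighbor_copy:
  assumes run: "async_primal_dual h g \<delta> Xs B \<gamma> \<rho> x0 \<mu>0 K S D x t \<mu> z"
    and "j \<in> essential_neighbors h g \<delta> i"
  shows "receives K S t i j k \<kappa> \<Longrightarrow> x i (Suc k) $ j = x j (Suc \<kappa>) $ j"
    and "\<nexists>\<kappa>. receives K S t i j k \<kappa> \<Longrightarrow> x i (Suc k) $ j = x i k $ j"
proof -
  have "\<forall>i k. \<forall>j\<in>essential_neighbors h g \<delta> i.
        (\<forall>\<kappa>. receives K S t i j k \<kappa> \<longrightarrow> x i (Suc k) $ j = x j (Suc \<kappa>) $ j) \<and>
        ((\<nexists>\<kappa>. receives K S t i j k \<kappa>) \<longrightarrow> x i (Suc k) $ j = x i k $ j)"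
    using run unfolding async_primal_dual_def by (elim conjE)
  with assms(2)
  show "receives K S t i j k \<kappa> \<Longrightarrow> x i (Suc k) $ j = x j (Suc \<kappa>) $ j"
    and "\<nexists>\<kappa>. receives K S t i j k \<kappa> \<Longrightarrow> x i (Suc k) $ j = x i k $ j"
    by blast+
qed

text \<open>The induction treats all times up to \<open>k\<close> together, since a received entry
  is one that its sender had at the earlier time \<open>Suc \<kappa>\<close>.\<close>

lemma async_primal_iterate_in_box:
  fixes x0 :: "real^'n"
  assumes run: "async_primal_dual h g \<delta> Xs B \<gamma> \<rho> x0 \<mu>0 K S D x t \<mu> z"
    and x0: "\<And>j. x0 $ j \<in> Xs j" and Xs: "\<And>j. closed (Xs j)"
  shows "x i k $ j \<in> Xs j"
proof -
  have "\<forall>s\<le>k. \<forall>i j. x i s $ j \<in> Xs j"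
  proof (induction k)
    case 0
    then show ?case using run x0 by (simp add: async_primal_dual_def)
  next
    case (Suc k)
    have old: "x i s $ j \<in> Xs j" if "s \<le> k" for i j s
      using Suc that by blast
    have "x i (Suc k) $ j \<in> Xs j" for i j
    proof (cases "j = i")
      case True
      have "closest_point (Xs i) a \<in> Xs i" for a
        using Xs x0 by (intro closest_point_in_set) auto
      with True old run show ?thesis by (simp add: async_primal_dual_def)
    next
      case False
      have "x i (Suc k) $ j = x i k $ j \<or> (\<exists>\<kappa><k. x i (Suc k) $ j = x j (Suc \<kappa>) $ j)"
      proof (cases "j \<in> essential_neighbors h g \<delta> i")
        case True
        show ?thesis
        proof (cases "\<exists>\<kappa>. receives K S t i j k \<kappa>")
          case received: True
          then obtain \<kappa> where "receives K S t i j k \<kappa>" ..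
          with async_neighbor_copy(1)[OF run True this] show ?thesis
            by (auto simp: receives_def computed_in_def)
        qed (use async_neighbor_copy(2)[OF run True] in blast)
      next
        case j: False
        with False run show ?thesis
          by (simp add: async_primal_dual_def)
      qed
      with old show ?thesis by (metis Suc_leI order_refl)
    qed
    with old show ?case by (simp add: le_Suc_eq)
  qed
  then show ?thesis by blast
qed

section \<open>One-step error and the convergence bound\<close>

text \<open>The projected step with \<open>muhat\<close> fixes \<open>xhat\<close>, and projection
  is nonexpansive. Before projection, the steps with \<open>\<mu>\<close> from \<open>y\<close> and
  from \<open>xhat\<close> are compared by the contraction; the rest is the change of the gradient
  at \<open>xhat\<close> between \<open>\<mu>\<close> and \<open>muhat\<close>, whose constant does
  not depend on the iterate.\<close>

lemma primal_step_error:
  fixes h :: "real^'n \<Rightarrow> real" and g :: "real^'n \<Rightarrow> real^'m"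
  assumes h: "twice_cont_diff h" "convex_on UNIV h"
    and g: "\<And>c. twice_cont_diff (\<lambda>y. g y $ c)" "\<And>c. convex_on UNIV (\<lambda>y. g y $ c)"
    and X: "X \<noteq> {}" "compact X" "convex X" "X = {y. \<forall>i. y $ i \<in> Xs i}"
    and dom: "diag_dominant h g \<delta> X \<beta>"
    and saddle: "is_saddle_point (lagrangian h g \<delta>) X nonneg_orthant xhat muhat"
    and "\<gamma> > 0" and \<mu>: "\<mu> \<in> nonneg_orthant"
    and step: "\<And>w. w \<in> X \<Longrightarrow> \<gamma> * \<bar>lagrangian_hessian h g \<delta> w \<mu> $ i $ i\<bar> \<le> 1"
    and y: "\<And>j. y $ j \<in> Xs j"
    and e: "\<And>j. j = i \<or> j \<in> essential_neighbors h g \<delta> i \<Longrightarrow> \<bar>y $ j - xhat $ j\<bar> \<le> e"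
  shows "\<bar>closest_point (Xs i) (y $ i - \<gamma> * lagrangian_grad h g \<delta> y \<mu> $ i) - xhat $ i\<bar>
    \<le> (1 - \<gamma> * \<beta>) * e
      + \<gamma> * ((\<Sum>c\<in>UNIV. norm (grad (\<lambda>y. g y $ c) xhat)) * norm (\<mu> - muhat))"
proof -
  let ?L = "\<lambda>y \<mu>. lagrangian_grad h g \<delta> y \<mu> $ i" and ?H = "lagrangian_hessian h g \<delta>"
  note Xs = box_factors[OF X(4) X(1-3)]
  have diff: "h differentiable (at x)" "(\<lambda>y. g y $ c) differentiable (at x)" for x c
    using h g by (auto simp: twice_cont_diff_def)
  have xhat: "xhat \<in> X" "\<And>y. y \<in> X \<Longrightarrow> lagrangian h g \<delta> xhat muhat \<le> lagrangian h g \<delta> y muhat"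
    using saddle by (auto simp: is_saddle_point_def)
  have fixed: "closest_point (Xs i) (xhat $ i - \<gamma> * ?L xhat muhat) = xhat $ i"
  proof (rule closest_point_gradient_step)
    fix a assume "a \<in> Xs i"
    then show "0 \<le> ?L xhat muhat * (a - xhat $ i)"
      by (intro box_minimizer_gradient[where f = "\<lambda>y. lagrangian h g \<delta> y muhat", OF X(4,3)]
          xhat lagrangian_grad_eq(1) diff)
  qed (use Xs \<open>\<gamma> > 0\<close> xhat(1) X(4) in auto)
  \<comment> \<open>The error bound \<open>e\<close> concerns only the entries in use. Setting the
    others to those of \<open>xhat\<close> leaves the \<open>i\<close>-th gradient entry unchanged,
    stays in \<open>X\<close> and gives the bound in all coordinates.\<close>
  define w where "w = (\<chi> j. if j = i \<or> j \<in> essential_neighbors h g \<delta> i then y $ j else xhat $ j)"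
  have "w \<in> X"
    using y xhat(1) by (auto simp: X(4) w_def)
  have "0 \<le> e"
    using e[of i] abs_ge_zero order_trans by blast
  have "?L y \<mu> = ?L w \<mu>"
    by (rule lagrangian_grad_essential[OF diff \<mu>]) (auto simp: w_def)
  moreover have "\<bar>(w $ i - \<gamma> * ?L w \<mu>) - (xhat $ i - \<gamma> * ?L xhat \<mu>)\<bar> \<le> (1 - \<gamma> * \<beta>) * e"
  proof (rule gradient_step_contraction[OF X(3) \<open>w \<in> X\<close> xhat(1) \<open>\<gamma> > 0\<close>])
    show "\<bar>w $ j - xhat $ j\<bar> \<le> e" for j
      using e \<open>0 \<le> e\<close> by (simp add: w_def)
    show "((\<lambda>y. lagrangian_grad h g \<delta> y \<mu>) has_derivative (\<lambda>v. ?H x \<mu> *v v)) (at x)" for x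
      by (rule lagrangian_hessian_eq(1)[OF h(1) g(1)])
    fix x assume "x \<in> X"
    have nonneg: "0 \<le> ?H x \<mu> $ i $ i"
      by (rule lagrangian_hessian_diagonal_nonneg[OF h g \<mu>])
    have "(\<Sum>j\<in>UNIV - {i}. \<bar>?H x \<mu> $ i $ j\<bar>) \<le> \<bar>?H x \<mu> $ i $ i\<bar> - \<beta>"
      using dom \<open>x \<in> X\<close> \<mu> unfolding diag_dominant_def by blast
    with nonneg show "(\<Sum>j\<in>UNIV - {i}. \<bar>?H x \<mu> $ i $ j\<bar>) + \<beta> \<le> ?H x \<mu> $ i $ i"
      by linarith
    show "\<gamma> * ?H x \<mu> $ i $ i \<le> 1"
      using step[OF \<open>x \<in> X\<close>] nonneg by simp
  qed
  moreover have "\<bar>\<gamma> * ?L xhat \<mu> - \<gamma> * ?L xhat muhat\<bar>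
      \<le> \<gamma> * ((\<Sum>c\<in>UNIV. norm (grad (\<lambda>y. g y $ c) xhat)) * norm (\<mu> - muhat))"
    using lagrangian_grad_lipschitz[OF diff] \<open>\<gamma> > 0\<close>
    by (simp add: right_diff_distrib[symmetric] abs_mult)
  ultimately have "\<bar>(y $ i - \<gamma> * ?L y \<mu>) - (xhat $ i - \<gamma> * ?L xhat muhat)\<bar>
      \<le> (1 - \<gamma> * \<beta>) * e + \<gamma> * ((\<Sum>c\<in>UNIV. norm (grad (\<lambda>y. g y $ c) xhat)) * norm (\<mu> - muhat))"
    by (simp add: w_def)
  moreover have "\<bar>closest_point (Xs i) (y $ i - \<gamma> * ?L y \<mu>) - xhat $ i\<bar>
      \<le> \<bar>(y $ i - \<gamma> * ?L y \<mu>) - (xhat $ i - \<gamma> * ?L xhat muhat)\<bar>"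
    using closest_point_lipschitz[OF Xs(3,2,1), of i "y $ i - \<gamma> * ?L y \<mu>" "xhat $ i - \<gamma> * ?L xhat muhat"]
    unfolding fixed dist_real_def .
  ultimately show ?thesis by linarith
qed

theorem theorem5:
  fixes h :: "real^'n \<Rightarrow> real" and g :: "real^'n \<Rightarrow> real^'m"
    and X :: "(real^'n) set" and Xs :: "'n \<Rightarrow> real set"
    and \<delta> \<beta> \<gamma> \<rho> B :: real
    and xbar xhat x0 :: "real^'n" and muhat \<mu>0 :: "real^'m"
    and N :: "'n \<Rightarrow> 'n set"
    and K :: "'n \<Rightarrow> nat set" and S :: "'n \<Rightarrow> 'n \<Rightarrow> nat set" and D :: "'n \<Rightarrow> 'm \<Rightarrow> nat set"
    and x :: "'n \<Rightarrow> nat \<Rightarrow> real^'n" and t :: "nat \<Rightarrow> 'm \<Rightarrow> nat"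
    and \<mu> :: "'m \<Rightarrow> nat \<Rightarrow> real" and z :: "'m \<Rightarrow> nat \<Rightarrow> real^'n"
  assumes "\<delta> > 0" and "\<beta> > 0" and "\<gamma> > 0" and "\<rho> > 0"
    and "twice_cont_diff h" and "convex_on UNIV h"
    and "slater_point g X xbar"
    and "\<And>j. twice_cont_diff (\<lambda>y. g y $ j)" and "\<And>j. convex_on UNIV (\<lambda>y. g y $ j)"
    and "X \<noteq> {}" and "compact X" and "convex X" and "X = {y. \<forall>i. y $ i \<in> Xs i}"
    and "diag_dominant h g \<delta> X \<beta>"
    and "is_saddle_point (lagrangian h g \<delta>) X nonneg_orthant xhat muhat"
    and "B = dual_bound h g X xbar"
    and "\<gamma> < 1 / max_row_sum h g \<delta> X (dual_set B)"
    and "x0 \<in> X" and "\<mu>0 \<in> dual_set B"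
    and "N = essential_neighbors h g \<delta>"
    and "async_primal_dual h g \<delta> Xs B \<gamma> \<rho> x0 \<mu>0 K S D x t \<mu> z"
  shows "\<exists>K1>0. \<exists>K2>0. \<forall>i k T. onboard t k T \<longrightarrow>
           norm (primal_vector N x i k - xhat)
             \<le> K1 * (1 - \<gamma> * \<beta>) ^ ops N K S t k T
               + K2 * norm (dual_vector \<mu> T - muhat)"
proof -
  note h = assms(5,6) and g = assms(8,9) and X = assms(10-13)
  note dom = assms(14) and saddle = assms(15) and N = assms(20) and run = assms(21)
  note Xs = box_factors[OF X(4) X(1-3)]
  define q where "q = 1 - \<gamma> * \<beta>"
  have xhat: "xhat \<in> X"
    using saddle by (simp add: is_saddle_point_def)
  have "continuous_on X h"
    using h by (intro differentiable_imp_continuous_on)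
      (auto simp: twice_cont_diff_def differentiable_on_def intro: differentiable_at_withinI)
  then have "bdd_below (h ` X)"
    using X by (intro bounded_imp_bdd_below compact_imp_bounded compact_continuous_image)
  then have muhat: "muhat \<in> dual_set B"
    unfolding assms(16) by (intro saddle_multiplier_in_dual_set[OF assms(1,7) saddle])
  obtain \<epsilon> where "\<epsilon> > 0"
    and \<epsilon>: "\<And>x \<mu> i. x \<in> X \<Longrightarrow> norm (\<mu> - muhat) \<le> \<epsilon> \<Longrightarrow> \<gamma> * \<bar>lagrangian_hessian h g \<delta> x \<mu> $ i $ i\<bar> \<le> 1"
    using step_size_admissible_near[OF h(1) g(1) X(2) assms(3,17) muhat] by metis
  \<comment> \<open>At the saddle point, dominance bounds a diagonal entry of the Hessian below by
    \<open>\<beta>\<close> in absolute value, and admissibility of the step size turns this into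
    \<open>\<gamma> * \<beta> \<le> 1\<close>. Any index serves.\<close>
  have "q \<ge> 0"
  proof -
    fix i :: 'n
    have "muhat \<in> nonneg_orthant"
      using muhat by (simp add: dual_set_def)
    then have "(\<Sum>j\<in>UNIV - {i}. \<bar>lagrangian_hessian h g \<delta> xhat muhat $ i $ j\<bar>)
        \<le> \<bar>lagrangian_hessian h g \<delta> xhat muhat $ i $ i\<bar> - \<beta>"
      using dom xhat by (auto simp: diag_dominant_def)
    moreover have "0 \<le> (\<Sum>j\<in>UNIV - {i}. \<bar>lagrangian_hessian h g \<delta> xhat muhat $ i $ j\<bar>)"
      by (rule sum_nonneg) simp
    ultimately have "\<beta> \<le> \<bar>lagrangian_hessian h g \<delta> xhat muhat $ i $ i\<bar>"
      by linarith
    then have "\<gamma> * \<beta> \<le> \<gamma> * \<bar>lagrangian_hessian h g \<delta> xhat muhat $ i $ i\<bar>"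
      using \<open>\<gamma> > 0\<close> by (intro mult_left_mono) auto
    also have "\<dots> \<le> 1"
      using \<open>\<epsilon> > 0\<close> by (intro \<epsilon> xhat) simp
    finally show ?thesis by (simp add: q_def)
  qed
  have "q < 1"
    using assms(2,3) by (simp add: q_def)
  obtain b where b: "\<And>y. y \<in> X \<Longrightarrow> norm y \<le> b"
    using compact_imp_bounded[OF X(2)] by (auto simp: bounded_iff)
  \<comment> \<open>Bounds every coordinate of a difference of two points of \<open>X\<close>; the
    summand \<open>1\<close> keeps it positive.\<close>
  define R where "R = 2 * \<bar>b\<bar> + 1"
  define n where "n = real CARD('n)"
  \<comment> \<open>The solution of \<open>C = q * C + \<gamma> * G\<close> with \<open>G\<close>
    the sum of the gradient norms, so that one step reproduces the part \<open>C * d\<close> of the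
    error bound exactly.\<close>
  define C where "C = \<gamma> * (\<Sum>c\<in>UNIV. norm (grad (\<lambda>y. g y $ c) xhat)) / (1 - q)"
  have "R > 0" "n > 0" "C \<ge> 0"
    using \<open>\<gamma> > 0\<close> \<open>q < 1\<close> by (auto simp: R_def n_def C_def intro!: divide_nonneg_nonneg mult_nonneg_nonneg sum_nonneg)
  have box: "x i k $ j \<in> Xs j" for i k j
    using async_primal_iterate_in_box[OF run] assms(18) Xs(2) X(4) by blast
  have diam: "\<bar>y $ j - xhat $ j\<bar> \<le> R" if "y \<in> X" for y j
    using component_le_norm_cart[of "y - xhat" j] norm_triangle_ineq4[of y xhat] b[OF that] b[OF xhat]
    by (simp add: R_def)
  \<comment> \<open>Entries that \<open>primal_vector\<close> reads off from their owners are
    covered by the case \<open>j = i\<close> for the owner. The factor \<open>n\<close> comes from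
    the l1-norm.\<close>
  have bound: "norm (primal_vector N x i k - xhat) \<le> n * e"
    if "\<And>i j. j = i \<or> j \<in> N i \<Longrightarrow> \<bar>x i k $ j - xhat $ j\<bar> \<le> e" for i k e
  proof -
    have "norm (primal_vector N x i k - xhat) \<le> (\<Sum>j\<in>UNIV. \<bar>(primal_vector N x i k - xhat) $ j\<bar>)"
      by (rule norm_le_l1_cart)
    also have "\<dots> \<le> (\<Sum>j\<in>(UNIV :: 'n set). e)"
      using that by (intro sum_mono) (simp add: primal_vector_def)
    finally show ?thesis by (simp add: n_def)
  qed
  \<comment> \<open>The coefficient adds up the needs of both cases: \<open>n * C\<close> for dual
    vectors within \<open>\<epsilon>\<close> of \<open>muhat\<close>, and
    \<open>n * R / \<epsilon>\<close> for the others, where this term alone exceeds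
    \<open>n * R\<close>.\<close>
  have main: "norm (primal_vector N x i k - xhat)
      \<le> n * R * q ^ ops N K S t k T + (n * R / \<epsilon> + n * C) * norm (dual_vector \<mu> T - muhat)"
    if onboard: "onboard t k T" for i k T
  proof (cases "norm (dual_vector \<mu> T - muhat) \<le> \<epsilon>")
    case True
    define d where "d = norm (dual_vector \<mu> T - muhat)"
    have \<mu>: "dual_vector \<mu> T \<in> nonneg_orthant"
      using onboard async_dual_iterate_nonneg[OF run assms(19)] by (auto simp: onboard_def)
    have "\<bar>x i k $ j - xhat $ j\<bar> \<le> R * q ^ ops N K S t k T + C * d" if "j = i \<or> j \<in> N i" for i j
    proof (rule async_error_bound[where E = "\<lambda>r. R * q ^ r + C * d" and N = N, OF _ _ _ _ _ _ _ onboard that])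
      show "t k \<le> t (Suc k)" for k
        by (rule async_dual_clock_mono[OF run])
      show "x i (Suc k) $ i = x i k $ i" if "k \<notin> K i" for i k
        using run that by (simp add: async_primal_dual_def)
      show "x i (Suc k) $ j = x j (Suc \<kappa>) $ j" if "j \<in> N i" "receives K S t i j k \<kappa>" for i j k \<kappa>
        using async_neighbor_copy(1)[OF run that(1)[unfolded N] that(2)] .
      show "x i (Suc k) $ j = x i k $ j" if "j \<in> N i" "\<nexists>\<kappa>. receives K S t i j k \<kappa>" for i j k
        using async_neighbor_copy(2)[OF run that(1)[unfolded N] that(2)] .
      show "R * q ^ Suc r + C * d \<le> R * q ^ r + C * d" for r
        using \<open>R > 0\<close> \<open>q \<ge> 0\<close> \<open>q < 1\<close> by (simp add: mult_left_le_one_le)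
      have "0 \<le> C * d"
        using \<open>C \<ge> 0\<close> by (simp add: d_def)
      then show "\<bar>x i k $ j - xhat $ j\<bar> \<le> R * q ^ 0 + C * d" for i k j
        using diam[of "x i k" j] box by (simp add: X(4))
      fix i k r
      assume k: "k \<in> K i" "t k = T"
        and near: "\<And>j. j = i \<or> j \<in> N i \<Longrightarrow> \<bar>x i k $ j - xhat $ j\<bar> \<le> R * q ^ r + C * d"
      have "x i (Suc k) $ i
          = closest_point (Xs i) (x i k $ i - \<gamma> * lagrangian_grad h g \<delta> (x i k) (dual_vector \<mu> T) $ i)"
        using run k by (simp add: async_primal_dual_def)
      then have "\<bar>x i (Suc k) $ i - xhat $ i\<bar> \<le> q * (R * q ^ r + C * d)
          + \<gamma> * ((\<Sum>c\<in>UNIV. norm (grad (\<lambda>y. g y $ c) xhat)) * d)"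
        unfolding q_def d_def
        using primal_step_error[OF h g X dom saddle \<open>\<gamma> > 0\<close> \<mu> \<epsilon>[OF _ True] box near[unfolded N d_def q_def]]
        by simp
      also have "\<dots> = R * q ^ Suc r + C * d"
        using \<open>q < 1\<close> by (simp add: C_def field_simps)
      finally show "\<bar>x i (Suc k) $ i - xhat $ i\<bar> \<le> R * q ^ Suc r + C * d" .
    qed
    then have "norm (primal_vector N x i k - xhat) \<le> n * (R * q ^ ops N K S t k T + C * d)"
      by (rule bound)
    also have "\<dots> \<le> n * (R * q ^ ops N K S t k T + C * d) + n * R / \<epsilon> * d"
      using \<open>n > 0\<close> \<open>R > 0\<close> \<open>\<epsilon> > 0\<close> by (simp add: d_def)
    finally show ?thesis
      by (simp add: d_def algebra_simps)
  next
    case False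
    have "norm (primal_vector N x i k - xhat) \<le> n * R"
      using box by (intro bound diam) (simp add: X(4))
    also have "\<dots> \<le> n * R / \<epsilon> * norm (dual_vector \<mu> T - muhat)"
      using False \<open>n > 0\<close> \<open>R > 0\<close> \<open>\<epsilon> > 0\<close> by (simp add: field_simps)
    also have "\<dots> \<le> n * R * q ^ ops N K S t k T + (n * R / \<epsilon> + n * C) * norm (dual_vector \<mu> T - muhat)"
      using \<open>n > 0\<close> \<open>R > 0\<close> \<open>C \<ge> 0\<close> \<open>q \<ge> 0\<close> by (simp add: algebra_simps)
    finally show ?thesis .
  qed
  show ?thesis
  proof (intro exI conjI allI impI)
    show "n * R > 0" "n * R / \<epsilon> + n * C > 0"
      using \<open>n > 0\<close> \<open>R > 0\<close> \<open>C \<ge> 0\<close> \<open>\<epsilon> > 0\<close> by (auto intro!: add_pos_nonneg)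
  qed (use main in \<open>simp add: q_def\<close>)
qed

end
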